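(* The problem ExactCover over definable structures is undecidable: there is no algorithm which, given (finite presentations of) a definable set $X$ and a definable set $\mathcal{S}$ of subsets of $X$, decides whether there is a pairwise-disjoint subset of $\mathcal{S}$ whose union is $X$.
   Context: Fix a countably infinite set $\mathbb{A}$ of atoms and an infinite set of atom variables. An expression is either a variable or a formal finite (possibly empty) union of set-builder expressions $\{e \mid x_1,\dots,x_k\in\mathbb{A},\ \varphi\}$ (with $k\ge 0$), where $e$ is an expression, the $x_i$ are bound variables, and $\varphi$ is a first-order formula over the atom variables with equality as the only relation symbol (interpreted in $(\mathbb{A},=)$). An expression $e$ with set of free variables $V$, together with a valuation $\sigma:V\to\mathbb{A}$, has a value $e[\sigma]$, defined in the obvious way by induction on $e$, which is an atom or a set; the sets arising this way are called definable. Pairs, tuples, integers, constants, disjoint unions etc. are encoded by standard set-theoretic means (e.g. $(x,y)=\{x,\{x,y\}\}$). A definable set is presented to an algorithm as a pair $(e,\sigma)$. Subfamilies sought as solutions are arbitrary (not required to be definable). *)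

theory Defs
  imports "HOL-Library.Countable_Set_Type" "HOL-Library.Nat_Bijection"
begin

section \<open>Formulas and expressions over atoms\<close>

type_synonym var = nat

datatype fm =
    Tru
  | Eq var var
  | Neg fm
  | Conj fm fm
  | Disj fm fm
  | Ex var fm
  | All var fm

primrec sat :: "fm \<Rightarrow> (var \<Rightarrow> 'a) \<Rightarrow> bool" where
  "sat Tru \<sigma> = True"
| "sat (Eq x y) \<sigma> = (\<sigma> x = \<sigma> y)"
| "sat (Neg \<phi>) \<sigma> = (\<not> sat \<phi> \<sigma>)"
| "sat (Conj \<phi> \<psi>) \<sigma> = (sat \<phi> \<sigma> \<and> sat \<psi> \<sigma>)"
| "sat (Disj \<phi> \<psi>) \<sigma> = (sat \<phi> \<sigma> \<or> sat \<psi> \<sigma>)"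
| "sat (Ex x \<phi>) \<sigma> = (\<exists>a. sat \<phi> (\<sigma>(x := a)))"
| "sat (All x \<phi>) \<sigma> = (\<forall>a. sat \<phi> (\<sigma>(x := a)))"

primrec fv_fm :: "fm \<Rightarrow> var set" where
  "fv_fm Tru = {}"
| "fv_fm (Eq x y) = {x, y}"
| "fv_fm (Neg \<phi>) = fv_fm \<phi>"
| "fv_fm (Conj \<phi> \<psi>) = fv_fm \<phi> \<union> fv_fm \<psi>"
| "fv_fm (Disj \<phi> \<psi>) = fv_fm \<phi> \<union> fv_fm \<psi>"
| "fv_fm (Ex x \<phi>) = fv_fm \<phi> - {x}"
| "fv_fm (All x \<phi>) = fv_fm \<phi> - {x}"

text \<open>\<open>SetExpr cs\<close> is the formal union of the set-builder expressions in \<open>cs\<close>, and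
  \<open>Builder e [x1, ..., xk] \<phi>\<close> is \<open>{e | x1, ..., xk \<in> A, \<phi>}\<close>; repeated bound variables are
  redundant.\<close>

datatype expr = Var var | SetExpr "builder list"
  and builder = Builder expr "var list" fm

fun fv :: "expr \<Rightarrow> var set" and fv_builder :: "builder \<Rightarrow> var set" where
  "fv (Var x) = {x}"
| "fv (SetExpr cs) = (\<Union>c\<in>set cs. fv_builder c)"
| "fv_builder (Builder e xs \<phi>) = (fv e \<union> fv_fm \<phi>) - set xs"

section \<open>Values\<close>

text \<open>Atoms are the elements of a type \<open>'a\<close>, countably infinite in the main theorem because of the
  bijection with \<open>nat\<close> assumed there. Since the atoms are countable, every value of an
  expression is an atom or a hereditarily countable set over the atoms; the following type contains
  all of these, with extensional equality.\<close>

datatype 'a obj = Atom 'a | Coll "'a obj cset"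

primrec is_coll :: "'a obj \<Rightarrow> bool" where
  "is_coll (Atom a) = False"
| "is_coll (Coll C) = True"

primrec elems :: "'a obj \<Rightarrow> 'a obj set" where
  "elems (Atom a) = {}"
| "elems (Coll C) = rcset C"

text \<open>Valuations are total functions here; only their restriction to the free variables matters
  (\<open>denot_cong\<close>). The use of \<open>acset\<close> is harmless by \<open>elems_denot\<close>.\<close>

fun denot :: "expr \<Rightarrow> (var \<Rightarrow> 'a::countable) \<Rightarrow> 'a obj"
  and members :: "builder \<Rightarrow> (var \<Rightarrow> 'a::countable) \<Rightarrow> 'a obj set" where
  "denot (Var x) \<sigma> = Atom (\<sigma> x)"
| "denot (SetExpr cs) \<sigma> = Coll (acset (\<Union>c\<in>set cs. members c \<sigma>))"
| "members (Builder e xs \<phi>) \<sigma> =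
     {denot e \<tau> |\<tau>. (\<forall>y. y \<notin> set xs \<longrightarrow> \<tau> y = \<sigma> y) \<and> sat \<phi> \<tau>}"

lemma countable_variants:
  fixes \<sigma> :: "var \<Rightarrow> 'a::countable"
  shows "countable {\<tau>. \<forall>y. y \<notin> set xs \<longrightarrow> \<tau> y = \<sigma> y}"
proof -
  let ?V = "{\<tau>. \<forall>y. y \<notin> set xs \<longrightarrow> \<tau> y = \<sigma> y}"
  have "inj_on (\<lambda>\<tau>. map \<tau> xs) ?V"
  proof (rule inj_onI)
    fix \<tau> \<tau>' assume "\<tau> \<in> ?V" "\<tau>' \<in> ?V" "map \<tau> xs = map \<tau>' xs"
    hence "\<tau> y = \<tau>' y" for y by (cases "y \<in> set xs") simp_all
    thus "\<tau> = \<tau>'" by (rule ext)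
  qed
  thus ?thesis
    by (rule countable_image_inj_on[rotated]) simp
qed

lemma countable_members: "countable (members c \<sigma>)"
proof (cases c)
  case (Builder e xs \<phi>)
  have "members c \<sigma> \<subseteq> denot e ` {\<tau>. \<forall>y. y \<notin> set xs \<longrightarrow> \<tau> y = \<sigma> y}"
    by (auto simp: Builder)
  thus ?thesis
    by (rule countable_subset) (intro countable_image countable_variants)
qed

lemma elems_denot: "elems (denot (SetExpr cs) \<sigma>) = (\<Union>c\<in>set cs. members c \<sigma>)"
proof -
  have "countable (\<Union>c\<in>set cs. members c \<sigma>)"
    by (intro countable_UN countable_finite finite_set countable_members)
  thus ?thesis by (simp add: acset_inverse)
qed

lemma sat_cong: "(\<And>x. x \<in> fv_fm \<phi> \<Longrightarrow> \<sigma> x = \<tau> x) \<Longrightarrow> sat \<phi> \<sigma> = sat \<phi> \<tau>"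
proof (induction \<phi> arbitrary: \<sigma> \<tau>)
  case (Ex x \<phi>)
  have "sat \<phi> (\<sigma>(x := a)) = sat \<phi> (\<tau>(x := a))" for a
    by (rule Ex.IH) (use Ex.prems in auto)
  thus ?case by simp
next
  case (All x \<phi>)
  have "sat \<phi> (\<sigma>(x := a)) = sat \<phi> (\<tau>(x := a))" for a
    by (rule All.IH) (use All.prems in auto)
  thus ?case by simp
next
  case (Conj \<phi> \<psi>)
  have "sat \<phi> \<sigma> = sat \<phi> \<tau>" "sat \<psi> \<sigma> = sat \<psi> \<tau>"
    using Conj.prems by (auto intro!: Conj.IH)
  thus ?case by simp
next
  case (Disj \<phi> \<psi>)
  have "sat \<phi> \<sigma> = sat \<phi> \<tau>" "sat \<psi> \<sigma> = sat \<psi> \<tau>"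
    using Disj.prems by (auto intro!: Disj.IH)
  thus ?case by simp
next
  case (Neg \<phi>)
  have "sat \<phi> \<sigma> = sat \<phi> \<tau>" using Neg.prems by (intro Neg.IH) auto
  thus ?case by simp
qed auto

lemma denot_cong:
  fixes \<sigma> \<tau> :: "var \<Rightarrow> 'a::countable"
  shows "(\<And>x. x \<in> fv e \<Longrightarrow> \<sigma> x = \<tau> x) \<Longrightarrow> denot e \<sigma> = denot e \<tau>"
    and "(\<And>x. x \<in> fv_builder c \<Longrightarrow> \<sigma> x = \<tau> x) \<Longrightarrow> members c \<sigma> = members c \<tau>"
proof (induction e and c arbitrary: \<sigma> \<tau> and \<sigma> \<tau>)
  case (SetExpr cs)
  have "members c \<sigma> = members c \<tau>" if "c \<in> set cs" for c
    by (rule SetExpr.IH[OF that]) (use SetExpr.prems that in auto)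
  thus ?case by simp
next
  case (Builder e xs \<phi>)
  have *: "members (Builder e xs \<phi>) \<sigma> \<subseteq> members (Builder e xs \<phi>) \<tau>"
    if eq: "\<And>x. x \<in> fv_builder (Builder e xs \<phi>) \<Longrightarrow> \<sigma> x = \<tau> x"
    for \<sigma> \<tau> :: "var \<Rightarrow> 'a"
  proof
    fix v assume "v \<in> members (Builder e xs \<phi>) \<sigma>"
    then obtain \<rho> where \<rho>: "v = denot e \<rho>" "\<forall>y. y \<notin> set xs \<longrightarrow> \<rho> y = \<sigma> y" "sat \<phi> \<rho>"
      by auto
    define \<rho>' where "\<rho>' = (\<lambda>y. if y \<in> set xs then \<rho> y else \<tau> y)"
    have "denot e \<rho> = denot e \<rho>'"
      by (rule Builder.IH) (use eq \<rho>(2) in \<open>auto simp: \<rho>'_def\<close>)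
    moreover have "sat \<phi> \<rho> = sat \<phi> \<rho>'"
      by (rule sat_cong) (use eq \<rho>(2) in \<open>auto simp: \<rho>'_def\<close>)
    ultimately show "v \<in> members (Builder e xs \<phi>) \<tau>"
      using \<rho> by (auto simp: \<rho>'_def intro!: exI[of _ \<rho>'])
  qed
  show ?case
    using *[of \<sigma> \<tau>] *[of \<tau> \<sigma>] Builder.prems by (metis subset_antisym)
qed auto

section \<open>Finite presentations\<close>

text \<open>In a pair \<open>(e, \<sigma>)\<close> the valuation, with domain exactly the set of free variables of \<open>e\<close>,
  is an association list.\<close>

type_synonym 'a pres = "expr \<times> (var \<times> 'a) list"

definition is_pres :: "'a pres \<Rightarrow> bool" where
  "is_pres = (\<lambda>(e, \<sigma>). distinct (map fst \<sigma>) \<and> set (map fst \<sigma>) = fv e)"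

definition pres_val :: "'a::countable pres \<Rightarrow> 'a obj" where
  "pres_val = (\<lambda>(e, \<sigma>). denot e (\<lambda>x. the (map_of \<sigma> x)))"

section \<open>The exact cover problem\<close>

definition set_system :: "'a obj \<Rightarrow> 'a obj \<Rightarrow> bool" where
  "set_system X S \<longleftrightarrow>
     is_coll X \<and> is_coll S \<and> (\<forall>A\<in>elems S. is_coll A \<and> elems A \<subseteq> elems X)"

definition has_exact_cover :: "'a obj \<Rightarrow> 'a obj \<Rightarrow> bool" where
  "has_exact_cover X S \<longleftrightarrow>
     (\<exists>T. T \<subseteq> elems S \<and> pairwise (\<lambda>A B. disjnt (elems A) (elems B)) T \<and>
          (\<Union>A\<in>T. elems A) = elems X)"

definition exact_cover_inputs :: "('a::countable pres \<times> 'a pres) set" where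
  "exact_cover_inputs =
     {(p, q). is_pres p \<and> is_pres q \<and> set_system (pres_val p) (pres_val q)}"

definition exact_cover_yes :: "('a::countable pres \<times> 'a pres) set" where
  "exact_cover_yes =
     {(p, q). (p, q) \<in> exact_cover_inputs \<and> has_exact_cover (pres_val p) (pres_val q)}"

section \<open>Numbering of presentations\<close>

primrec fm_code :: "fm \<Rightarrow> nat" where
  "fm_code Tru = prod_encode (0, 0)"
| "fm_code (Eq x y) = prod_encode (1, prod_encode (x, y))"
| "fm_code (Neg \<phi>) = prod_encode (2, fm_code \<phi>)"
| "fm_code (Conj \<phi> \<psi>) = prod_encode (3, prod_encode (fm_code \<phi>, fm_code \<psi>))"
| "fm_code (Disj \<phi> \<psi>) = prod_encode (4, prod_encode (fm_code \<phi>, fm_code \<psi>))"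
| "fm_code (Ex x \<phi>) = prod_encode (5, prod_encode (x, fm_code \<phi>))"
| "fm_code (All x \<phi>) = prod_encode (6, prod_encode (x, fm_code \<phi>))"

fun expr_code :: "expr \<Rightarrow> nat" and builder_code :: "builder \<Rightarrow> nat" where
  "expr_code (Var x) = prod_encode (0, x)"
| "expr_code (SetExpr cs) = prod_encode (1, list_encode (map builder_code cs))"
| "builder_code (Builder e xs \<phi>) =
     prod_encode (expr_code e, prod_encode (list_encode xs, fm_code \<phi>))"

text \<open>Atoms enter the codes of valuations through a numbering \<open>\<nu>\<close> of the atoms.\<close>

definition pres_code :: "('a \<Rightarrow> nat) \<Rightarrow> 'a pres \<Rightarrow> nat" where
  "pres_code \<nu> = (\<lambda>(e, \<sigma>).
     prod_encode (expr_code e, list_encode (map (\<lambda>(x, a). prod_encode (x, \<nu> a)) \<sigma>)))"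

definition input_code :: "('a \<Rightarrow> nat) \<Rightarrow> 'a pres \<times> 'a pres \<Rightarrow> nat" where
  "input_code \<nu> = (\<lambda>(p, q). prod_encode (pres_code \<nu> p, pres_code \<nu> q))"

section \<open>Decidability\<close>

text \<open>Algorithms are partial (\<open>\<mu>\<close>-)recursive functions; \<open>computes f xs y\<close> says that \<open>f\<close> halts
  on the argument tuple \<open>xs\<close> with result \<open>y\<close>.\<close>

datatype recf =
    Zero
  | Succ
  | Proj nat
  | Comp recf "recf list"
  | PrimRec recf recf
  | Mu recf

inductive computes :: "recf \<Rightarrow> nat list \<Rightarrow> nat \<Rightarrow> bool" where
  Zero: "computes Zero xs 0"
| Succ: "computes Succ [x] (Suc x)"
| Proj: "i < length xs \<Longrightarrow> computes (Proj i) xs (xs ! i)"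
| Comp: "list_all2 (\<lambda>g y. computes g xs y) gs ys \<Longrightarrow> computes f ys z \<Longrightarrow>
    computes (Comp f gs) xs z"
| PrimRec_0: "computes f xs y \<Longrightarrow> computes (PrimRec f g) (0 # xs) y"
| PrimRec_Suc: "computes (PrimRec f g) (n # xs) r \<Longrightarrow> computes g (n # r # xs) y \<Longrightarrow>
    computes (PrimRec f g) (Suc n # xs) y"
| Mu: "computes f (n # xs) 0 \<Longrightarrow> (\<And>m. m < n \<Longrightarrow> \<exists>k. computes f (m # xs) (Suc k)) \<Longrightarrow>
    computes (Mu f) xs n"

inductive_cases computes_ZeroE: "computes Zero xs y"
  and computes_SuccE: "computes Succ xs y"
  and computes_ProjE: "computes (Proj i) xs y"
  and computes_CompE: "computes (Comp f gs) xs y"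
  and computes_PrimRec_0E: "computes (PrimRec f g) (0 # xs) y"
  and computes_PrimRec_SucE: "computes (PrimRec f g) (Suc n # xs) y"
  and computes_MuE: "computes (Mu f) xs y"

lemma computes_deterministic: "computes f xs y \<Longrightarrow> computes f xs z \<Longrightarrow> y = z"
proof (induction arbitrary: z rule: computes.induct)
  case (Comp xs gs ys f z z')
  from Comp.prems obtain ys' where ys': "list_all2 (\<lambda>g y. computes g xs y) gs ys'"
    "computes f ys' z'" by (rule computes_CompE)
  have "ys = ys'"
    using Comp.IH(1) ys'(1) by (auto simp: list_all2_conv_all_nth intro!: nth_equalityI)
  thus ?case using Comp.IH(2) ys'(2) by simp
next
  case (PrimRec_Suc f g n xs r y)
  from PrimRec_Suc.prems obtain r' where "computes (PrimRec f g) (n # xs) r'"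
    "computes g (n # r' # xs) z" by (rule computes_PrimRec_SucE)
  thus ?case using PrimRec_Suc.IH by blast
next
  case (Mu f n xs)
  from Mu.prems have z: "computes f (z # xs) 0"
    and less: "\<And>m. m < z \<Longrightarrow> \<exists>k. computes f (m # xs) (Suc k)"
    by (auto elim: computes_MuE)
  have "\<not> n < z" using less Mu.IH(1) by blast
  moreover have "\<not> z < n" using z Mu.IH(2) by blast
  ultimately show ?case by simp
next
  case (PrimRec_0 f xs y g)
  from PrimRec_0.prems have "computes f xs z" by (rule computes_PrimRec_0E)
  thus ?case by (rule PrimRec_0.IH)
qed (blast elim: computes_ZeroE computes_SuccE computes_ProjE)+

text \<open>The problem of telling the elements of \<open>Y\<close> among the inputs \<open>I\<close>, which are given to the
  algorithm by their codes. Nothing is required of the algorithm on numbers that are not codes of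
  elements of \<open>I\<close>.\<close>

definition decidable_problem :: "('i \<Rightarrow> nat) \<Rightarrow> 'i set \<Rightarrow> 'i set \<Rightarrow> bool" where
  "decidable_problem code I Y \<longleftrightarrow>
     (\<exists>f. \<forall>i\<in>I. computes f [code i] (if i \<in> Y then 1 else 0))"

end

theory Submission
  imports Defs
begin

text \<open>A cover has to be a truth assignment: two infinite but definable sets compete for every fact
  (a 4-tuple of atoms), and the chosen one covers all occurrences of literals at that fact that
  become false. Every instance of a clause must be covered together with one of its remaining, hence
  true, literals. So exact cover expresses the satisfiability of definable, possibly infinite, clauses
  in relations over the atoms. A successor relation is axiomatized by the infinite clauses
  \<open>\<Or>y. S x y\<close>, and Horn clauses mirroring the rules of \<open>computes\<close> then force the relation
  "program \<open>p\<close> returns \<open>y\<close> on \<open>l\<close>" to hold at least where it should. Forbidding any result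
  for program \<open>m\<close> on input \<open>m\<close> gives an instance that has a cover iff this run does not halt,
  and a decision procedure is refuted by diagonalization.\<close>

section \<open>Exact covers by tuples of atoms\<close>

text \<open>Equality is the only relation on atoms, so clause indices, relation indices, signs and
  numerals must themselves be atoms, supplied as parameters. An occurrence has 19 = 1 + 13 + 1 + 4
  entries: clause index, values of 13 variables (as many as the successor rule for
  \<open>PrimRec\<close> uses), sign, and a fact made of a relation index and three arguments.
  Facts, clause instances and occurrences thus have lengths 4, 14 and 19 and cannot be confused.
  Nothing forces the successor relation of a cover to be functional or injective, so numbers need
  not be represented faithfully. This is harmless: choosing successors maps the naturals into the
  atoms, and derivations by Horn rules can be carried out along this map. Conversely, if the run
  does not halt, the least relations closed under the rules, moved to the atoms by their numbering,
  satisfy every clause. To name \<open>m\<close> itself, a chain of parameters is linked by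
  successor facts, so the instance grows with \<open>m\<close>.\<close>

definition tt_set :: "'a list set \<Rightarrow> 'a \<Rightarrow> 'a list \<Rightarrow> 'a list set" where
  "tt_set L z a = insert a {v \<in> L. drop 15 v = a \<and> v ! 14 \<noteq> z}"

definition ff_set :: "'a list set \<Rightarrow> 'a \<Rightarrow> 'a list \<Rightarrow> 'a list set" where
  "ff_set L z a = insert a {v \<in> L. drop 15 v = a \<and> v ! 14 = z}"

definition cover_universe :: "'a list set \<Rightarrow> 'a list set" where
  "cover_universe L = {a. length a = 4} \<union> take 14 ` L \<union> L"

text \<open>A pair selects one true occurrence as the witness of its clause instance; the singletons
  take up the true occurrences that were not selected.\<close>

definition cover_family :: "'a list set \<Rightarrow> 'a \<Rightarrow> 'a list set set" where
  "cover_family L z = tt_set L z ` {a. length a = 4} \<union> ff_set L z ` {a. length a = 4} \<union>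
     (\<lambda>v. {take 14 v, v}) ` L \<union> (\<lambda>v. {v}) ` L"

definition satisfied :: "'a list set \<Rightarrow> 'a \<Rightarrow> ('a list \<Rightarrow> bool) \<Rightarrow> bool" where
  "satisfied L z R \<longleftrightarrow>
     (\<forall>v\<in>L. \<exists>w\<in>L. take 14 w = take 14 v \<and> (R (drop 15 w) \<longleftrightarrow> w ! 14 = z))"

lemma cover_family_cases:
  assumes "B \<in> cover_family L z"
  obtains (tt) a where "length a = 4" "B = tt_set L z a"
    | (ff) a where "length a = 4" "B = ff_set L z a"
    | (witness) v where "v \<in> L" "B = {take 14 v, v}"
    | (slack) v where "v \<in> L" "B = {v}"
  using assms unfolding cover_family_def by (elim UnE imageE) simp_all

lemma cover_family_subset:
  "B \<in> cover_family L z \<Longrightarrow> B \<subseteq> cover_universe L"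
  unfolding cover_family_def cover_universe_def tt_set_def ff_set_def by auto

text \<open>A clause instance can only be covered by a pair with some occurrence \<open>w\<close>.
  The set covering the fact of \<open>w\<close> is disjoint from that pair, so the truth value it
  stands for does not falsify \<open>w\<close>.\<close>

lemma satisfied_of_cover:
  assumes len: "\<And>v. v \<in> L \<Longrightarrow> length v = 19"
    and T: "T \<subseteq> cover_family L z" and disj: "pairwise disjnt T" and un: "\<Union>T = cover_universe L"
  shows "satisfied L z (\<lambda>a. tt_set L z a \<in> T)"
  unfolding satisfied_def
proof
  \<comment> \<open>Here and in \<open>choice\<close>, the length of an element decides which kinds
    of sets can contain it.\<close>
  have witness: "\<exists>w\<in>L. B = {take 14 w, w} \<and> take 14 w = c"
    if "B \<in> cover_family L z" "c \<in> B" "length c = 14" for B c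
    using that(1)
  proof (cases rule: cover_family_cases)
    case (tt a)
    then have "c = a \<or> c \<in> L" using that(2) by (simp add: tt_set_def) blast
    then show ?thesis using tt that(3) len[of c] by force
  next
    case (ff a)
    then have "c = a \<or> c \<in> L" using that(2) by (simp add: ff_set_def) blast
    then show ?thesis using ff that(3) len[of c] by force
  next
    case (witness v)
    moreover have "c \<noteq> v" using that(3) len[OF witness(1)] by auto
    ultimately show ?thesis using that(2) by blast
  next
    case (slack v)
    then have "c = v" using that(2) by blast
    then show ?thesis using that(3) len[OF slack(1)] by simp
  qed
  have choice: "B = tt_set L z a \<or> B = ff_set L z a"
    if "B \<in> cover_family L z" "a \<in> B" "length a = 4" for B a
    using that(1)
  proof (cases rule: cover_family_cases)
    case (tt b)
    then have "a = b \<or> a \<in> L" using that(2) by (simp add: tt_set_def) blast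
    then show ?thesis using tt that(3) len[of a] by force
  next
    case (ff b)
    then have "a = b \<or> a \<in> L" using that(2) by (simp add: ff_set_def) blast
    then show ?thesis using ff that(3) len[of a] by force
  next
    case (witness v)
    have "length (take 14 v) = 14" using len[OF witness(1)] by simp
    then have "a \<noteq> take 14 v" "a \<noteq> v" using that(3) len[OF witness(1)] by auto
    then show ?thesis using that(2) witness(2) by blast
  next
    case (slack v)
    then have "a = v" using that(2) by blast
    then show ?thesis using that(3) len[OF slack(1)] by simp
  qed
  fix v assume v: "v \<in> L"
  have "take 14 v \<in> \<Union>T" using v unfolding un cover_universe_def by blast
  then obtain B where B: "B \<in> T" "take 14 v \<in> B" by blast
  have "length (take 14 v) = 14" using len[OF v] by simp
  then obtain w where w: "w \<in> L" "B = {take 14 w, w}" "take 14 w = take 14 v"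
    using witness[of B "take 14 v"] B T by blast
  define a where "a = drop 15 w"
  have la: "length a = 4" using len[OF w(1)] by (simp add: a_def)
  have "a \<in> \<Union>T" using la unfolding un cover_universe_def by blast
  then obtain C where C: "C \<in> T" "a \<in> C" by blast
  then have "C = tt_set L z a \<or> C = ff_set L z a"
    using choice la T by blast
  then have "tt_set L z a \<in> T \<or> ff_set L z a \<in> T" using C(1) by blast
  moreover have "length (take 14 w) = 14" using len[OF w(1)] by simp
  then have "a \<noteq> take 14 w" "a \<noteq> w" using la len[OF w(1)] by auto
  then have "a \<notin> B" using w(2) by blast
  have "w \<notin> C" if C: "C \<in> T" "a \<in> C" for C
  proof -
    have "B \<noteq> C" using \<open>a \<notin> B\<close> C(2) by blast
    then have "B \<inter> C = {}" using pairwiseD[OF disj B(1) C(1)] by (simp add: disjnt_def)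
    then show ?thesis using w(2) by blast
  qed
  then have "w \<notin> tt_set L z a \<or> tt_set L z a \<notin> T" "w \<notin> ff_set L z a \<or> ff_set L z a \<notin> T"
    unfolding tt_set_def ff_set_def by blast+
  ultimately have "tt_set L z a \<in> T \<longleftrightarrow> w ! 14 = z"
    using w(1) unfolding tt_set_def ff_set_def a_def by blast
  then show "\<exists>w\<in>L. take 14 w = take 14 v \<and> (tt_set L z (drop 15 w) \<in> T \<longleftrightarrow> w ! 14 = z)"
    using w unfolding a_def by blast
qed

lemma cover_of_satisfied:
  assumes len: "\<And>v. v \<in> L \<Longrightarrow> length v = 19" and sat: "satisfied L z R"
  shows "\<exists>T\<subseteq>cover_family L z. pairwise disjnt T \<and> \<Union>T = cover_universe L"
proof -
  define good where "good v \<longleftrightarrow> (R (drop 15 v) \<longleftrightarrow> v ! 14 = z)" for v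
  have "\<exists>g. \<forall>c\<in>take 14 ` L. g c \<in> L \<and> take 14 (g c) = c \<and> good (g c)"
    using sat unfolding satisfied_def good_def by (intro bchoice) fast
  then obtain g where g: "\<And>v. v \<in> L \<Longrightarrow>
      g (take 14 v) \<in> L \<and> take 14 (g (take 14 v)) = take 14 v \<and> good (g (take 14 v))"
    by blast
  define T where "T = tt_set L z ` {a. length a = 4 \<and> R a} \<union>
    ff_set L z ` {a. length a = 4 \<and> \<not> R a} \<union>
    (\<lambda>v. {take 14 v, v}) ` {v \<in> L. g (take 14 v) = v} \<union>
    (\<lambda>v. {v}) ` {v \<in> L. good v \<and> g (take 14 v) \<noteq> v}"
  \<comment> \<open>The only member of \<open>T\<close> that may contain \<open>x\<close>: a false
    occurrence belongs to the set chosen for its fact, a true one to its pair if \<open>g\<close>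
    selected it, and to its singleton otherwise. Uniqueness of the owner gives disjointness, its
    existence gives covering.\<close>
  define owner where "owner x =
    (if length x = 4 then (if R x then tt_set L z x else ff_set L z x)
     else if length x = 14 then {x, g x}
     else if \<not> good x then
       (if R (drop 15 x) then tt_set L z (drop 15 x) else ff_set L z (drop 15 x))
     else if g (take 14 x) = x then {take 14 x, x} else {x})" for x
  have sub: "T \<subseteq> cover_family L z"
    unfolding T_def cover_family_def by auto
  have own: "B = owner x" if "B \<in> T" "x \<in> B" for B x
  proof -
    have good_g: "good v" if "v \<in> L" "g (take 14 v) = v" for v
      using g[OF that(1)] that(2) by simp
    consider (t) a where "length a = 4" "R a" "B = tt_set L z a"
      | (f) a where "length a = 4" "\<not> R a" "B = ff_set L z a"
      | (w) v where "v \<in> L" "g (take 14 v) = v" "B = {take 14 v, v}"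
      | (s) v where "v \<in> L" "good v" "g (take 14 v) \<noteq> v" "B = {v}"
      using \<open>B \<in> T\<close> unfolding T_def by blast
    then show ?thesis
    proof cases
      case t
      then show ?thesis using \<open>x \<in> B\<close> len
        by (auto simp: owner_def tt_set_def good_def)
    next
      case f
      then show ?thesis using \<open>x \<in> B\<close> len
        by (auto simp: owner_def ff_set_def good_def)
    next
      case w
      then show ?thesis using \<open>x \<in> B\<close> len[of v] good_g[of v]
        by (auto simp: owner_def)
    next
      case s
      then show ?thesis using \<open>x \<in> B\<close> len[of v] by (auto simp: owner_def)
    qed
  qed
  have mem: "owner x \<in> T \<and> x \<in> owner x" if xU: "x \<in> cover_universe L" for x
  proof -
    consider (a) "length x = 4" | (c) v where "v \<in> L" "x = take 14 v" | (v) "x \<in> L"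
      using xU unfolding cover_universe_def by (auto simp: image_iff)
    then show ?thesis
    proof cases
      case a
      then show ?thesis by (auto simp: owner_def T_def tt_set_def ff_set_def)
    next
      case c
      then have ow: "owner x = {take 14 (g x), g x}"
        and "g x \<in> L" "g (take 14 (g x)) = g x"
        using len[of v] g[of v] by (auto simp: owner_def)
      then have "owner x \<in> (\<lambda>v. {take 14 v, v}) ` {v \<in> L. g (take 14 v) = v}"
        by (intro image_eqI[of _ _ "g x"]) auto
      then show ?thesis using ow c g[of v] unfolding T_def by auto
    next
      case v
      then show ?thesis using len[of x]
        by (auto simp: owner_def T_def tt_set_def ff_set_def good_def)
    qed
  qed
  have "pairwise disjnt T"
    unfolding pairwise_def disjnt_def using own by blast
  moreover have "\<Union>T = cover_universe L"
    using mem sub cover_family_subset[of _ L z] by blast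
  ultimately show ?thesis using sub by blast
qed

section \<open>Definable tuples\<close>

definition coll :: "'a obj set \<Rightarrow> 'a obj" where
  "coll B = Coll (acset B)"

lemma elems_coll: "countable B \<Longrightarrow> elems (coll B) = B"
  by (simp add: coll_def acset_inverse)

lemma is_coll_coll [simp]: "is_coll (coll B)"
  by (simp add: coll_def)

text \<open>An atom \<open>x\<close> and a set \<open>u\<close> can be recovered from \<open>{x, u}\<close>, so unordered pairs suffice here.\<close>

primrec tup :: "'a list \<Rightarrow> 'a obj" where
  "tup [] = coll {}"
| "tup (x # xs) = coll {Atom x, tup xs}"

primrec tup_expr :: "var list \<Rightarrow> expr" where
  "tup_expr [] = SetExpr []"
| "tup_expr (x # xs) = SetExpr [Builder (Var x) [] Tru, Builder (tup_expr xs) [] Tru]"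

lemma is_coll_tup [simp]: "is_coll (tup xs)"
  by (cases xs) auto

lemma elems_tup [simp]:
  "elems (tup []) = {}" "elems (tup (x # xs)) = {Atom x, tup xs}"
  by (simp_all add: elems_coll)

lemma inj_tup: "inj tup"
proof
  fix xs ys :: "'a list"
  show "tup xs = tup ys \<Longrightarrow> xs = ys"
  proof (induction xs arbitrary: ys)
    case Nil
    then have "elems (tup ys) = {}" by (metis elems_tup(1))
    then show ?case by (cases ys) (simp_all del: tup.simps)
  next
    case (Cons x xs)
    have "elems (tup ys) \<noteq> {}" unfolding Cons.prems[symmetric] elems_tup by simp
    then obtain y ys' where ys: "ys = y # ys'"
      by (cases ys) (simp_all del: tup.simps)
    have "{Atom x, tup xs} = {Atom y, tup ys'}"
      using arg_cong[OF Cons.prems, of elems] by (simp only: ys elems_tup)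
    moreover have "tup xs \<noteq> Atom y" "tup ys' \<noteq> Atom x"
      by (metis is_coll.simps(1) is_coll_tup)+
    ultimately have "x = y" "tup xs = tup ys'" by (auto simp: doubleton_eq_iff)
    then show ?case using Cons.IH ys by simp
  qed
qed

lemma members_unit: "members (Builder e [] Tru) \<sigma> = {denot e \<sigma>}"
  by (auto simp flip: fun_eq_iff)

lemma denot_SetExpr: "denot (SetExpr cs) \<sigma> = coll (\<Union>c\<in>set cs. members c \<sigma>)"
  by (simp add: coll_def)

lemma denot_tup_expr: "denot (tup_expr xs) \<sigma> = tup (map \<sigma> xs)"
  by (induction xs) (simp_all add: denot_SetExpr members_unit insert_commute del: denot.simps(2) members.simps)

lemma fv_tup_expr [simp]: "fv (tup_expr xs) = set xs"
  by (induction xs) auto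

definition tup_set :: "'a list set \<Rightarrow> 'a obj" where
  "tup_set B = coll (tup ` B)"

lemma elems_tup_set [simp]: "elems (tup_set B) = tup ` B" for B :: "'a::countable list set"
  by (simp add: tup_set_def elems_coll)

lemma has_exact_cover_iff:
  fixes U :: "'a::countable list set"
  assumes "elems X = tup ` U" "elems S = tup_set ` F"
  shows "has_exact_cover X S \<longleftrightarrow> (\<exists>T\<subseteq>F. pairwise disjnt T \<and> \<Union>T = U)"
proof -
  have disj: "disjnt (tup ` A) (tup ` B) \<longleftrightarrow> disjnt A B" for A B :: "'a list set"
    by (simp add: disjnt_def image_Int[OF inj_tup, symmetric])
  have inj: "tup_set A = tup_set B \<longleftrightarrow> A = B" for A B :: "'a list set"
  proof
    assume "tup_set A = tup_set B"
    then have "tup ` A = tup ` B" by (metis elems_tup_set)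
    then show "A = B" by (simp add: inj_image_eq_iff[OF inj_tup])
  qed simp
  have un: "(\<Union>A\<in>tup_set ` T. elems A) = tup ` U \<longleftrightarrow> \<Union>T = U" for T
    using inj_image_eq_iff[OF inj_tup, of "\<Union>T" U] by (simp add: image_Union)
  have pw: "pairwise (\<lambda>A B. disjnt (elems A) (elems B)) (tup_set ` T) \<longleftrightarrow> pairwise disjnt T"
    for T :: "'a list set set"
    by (simp add: pairwise_def inj disj)
  show ?thesis
    unfolding has_exact_cover_def assms
  proof (intro iffI; elim exE conjE)
    fix T assume T: "T \<subseteq> tup_set ` F"
      "pairwise (\<lambda>A B. disjnt (elems A) (elems B)) T" "(\<Union>A\<in>T. elems A) = tup ` U"
    then obtain T' where "T' \<subseteq> F" "T = tup_set ` T'" by (auto simp: subset_image_iff)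
    moreover from this T pw[of T'] un[of T'] have "pairwise disjnt T'" "\<Union>T' = U" by simp_all
    ultimately show "\<exists>T\<subseteq>F. pairwise disjnt T \<and> \<Union>T = U" by blast
  next
    fix T assume T: "T \<subseteq> F" "pairwise disjnt T" "\<Union>T = U"
    then show "\<exists>T. T \<subseteq> tup_set ` F \<and> pairwise (\<lambda>A B. disjnt (elems A) (elems B)) T \<and>
        (\<Union>A\<in>T. elems A) = tup ` U"
      by (intro exI[of _ "tup_set ` T"] conjI image_mono pw[THEN iffD2] un[THEN iffD2])
  qed
qed

text \<open>Variable layout: \<open>0, ..., 13\<close> name a clause instance, \<open>14\<close> is the polarity, \<open>15, ..., 18\<close>
  are the arguments of a fact, and all larger variables are parameters. Parameter \<open>19\<close>
  is the value of \<open>14\<close> that marks positive literals.\<close>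

definition clause_vars :: "var list" where "clause_vars = [0..<14]"
definition fact_vars :: "var list" where "fact_vars = [15..<19]"
definition bound_vars :: "var list" where "bound_vars = [0..<19]"
definition clause_pol_vars :: "var list" where "clause_pol_vars = [0..<15]"

text \<open>The fact variables stay free while those of the clause and the sign are bound, so one
  expression serves all facts; \<open>\<psi>\<close> selects the sign of the occurrences that become
  false.\<close>

definition fact_expr :: "fm \<Rightarrow> fm \<Rightarrow> expr" where
  "fact_expr \<phi> \<psi> = SetExpr [Builder (tup_expr fact_vars) [] Tru,
     Builder (tup_expr bound_vars) clause_pol_vars (Conj \<phi> \<psi>)]"

definition universe_expr :: "fm \<Rightarrow> expr" where
  "universe_expr \<phi> = SetExpr [Builder (tup_expr fact_vars) bound_vars Tru,
     Builder (tup_expr clause_vars) bound_vars \<phi>, Builder (tup_expr bound_vars) bound_vars \<phi>]"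

definition family_expr :: "fm \<Rightarrow> expr" where
  "family_expr \<phi> = SetExpr [
     Builder (fact_expr \<phi> (Neg (Eq 14 19))) fact_vars Tru,
     Builder (fact_expr \<phi> (Eq 14 19)) fact_vars Tru,
     Builder (SetExpr [Builder (tup_expr clause_vars) [] Tru, Builder (tup_expr bound_vars) [] Tru])
       bound_vars \<phi>,
     Builder (SetExpr [Builder (tup_expr bound_vars) [] Tru]) bound_vars \<phi>]"

definition occurrences :: "fm \<Rightarrow> (var \<Rightarrow> 'a) \<Rightarrow> 'a list set" where
  "occurrences \<phi> \<sigma> = {map \<tau> bound_vars |\<tau>. (\<forall>y\<ge>19. \<tau> y = \<sigma> y) \<and> sat \<phi> \<tau>}"

lemma map_bound_vars:
  "length (map \<tau> bound_vars) = 19" "take 14 (map \<tau> bound_vars) = map \<tau> clause_vars"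
  "drop 15 (map \<tau> bound_vars) = map \<tau> fact_vars" "map \<tau> bound_vars ! 14 = \<tau> 14"
  by (simp_all add: bound_vars_def clause_vars_def fact_vars_def take_map drop_map del: upt_rec_numeral)

lemma set_vars:
  "set clause_vars = {..<14}" "set fact_vars = {15..<19}" "set bound_vars = {..<19}"
  "set clause_pol_vars = {..<15}"
  by (auto simp: bound_vars_def clause_vars_def fact_vars_def clause_pol_vars_def simp del: upt_rec_numeral)

lemma length_fact_vars: "length fact_vars = 4"
  by (simp add: fact_vars_def del: upt_rec_numeral)

lemma nth_fact_vars: "i < 4 \<Longrightarrow> fact_vars ! i = 15 + i"
  by (simp add: fact_vars_def del: upt_rec_numeral)

lemma length_occurrences: "v \<in> occurrences \<phi> \<sigma> \<Longrightarrow> length v = 19"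
  using map_bound_vars(1) unfolding occurrences_def by blast

lemma image_setcompr: "(\<And>t. Q t \<Longrightarrow> f t = h (g t)) \<Longrightarrow> {f t |t. Q t} = h ` {g t |t. Q t}"
  unfolding setcompr_eq_image image_image by (intro image_cong) auto

lemma members_tup_expr:
  "members (Builder (tup_expr xs) ys \<psi>) \<sigma> =
     tup ` {map \<tau> xs |\<tau>. (\<forall>y. y \<notin> set ys \<longrightarrow> \<tau> y = \<sigma> y) \<and> sat \<psi> \<tau>}"
  by (auto simp: denot_tup_expr)

lemma all_lists_fact_vars:
  assumes "set fact_vars \<subseteq> set ys"
  shows "{map \<tau> fact_vars |\<tau>. \<forall>y. y \<notin> set ys \<longrightarrow> \<tau> y = \<sigma> y} = {a. length a = 4}"
proof (intro equalityI subsetI; elim CollectE)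
  fix a :: "'a list" assume a: "length a = 4"
  let ?\<tau> = "\<lambda>y. if y \<in> set fact_vars then a ! (y - 15) else \<sigma> y"
  have "a = map ?\<tau> fact_vars"
    using a by (intro nth_equalityI) (simp_all add: length_fact_vars nth_fact_vars set_vars)
  moreover have "\<forall>y. y \<notin> set ys \<longrightarrow> ?\<tau> y = \<sigma> y" using assms by auto
  ultimately show "a \<in> {map \<tau> fact_vars |\<tau>. \<forall>y. y \<notin> set ys \<longrightarrow> \<tau> y = \<sigma> y}" by blast
qed (auto simp: length_fact_vars)

lemma elems_universe_expr:
  "elems (denot (universe_expr \<phi>) \<sigma>) = tup ` cover_universe (occurrences \<phi> \<sigma>)"
proof -
  have 1: "members (Builder (tup_expr fact_vars) bound_vars Tru) \<sigma> = tup ` {a. length a = 4}"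
  proof -
    have "set fact_vars \<subseteq> set bound_vars" by (auto simp: set_vars)
    then show ?thesis unfolding members_tup_expr using all_lists_fact_vars[of bound_vars \<sigma>] by simp
  qed
  have 2: "members (Builder (tup_expr clause_vars) bound_vars \<phi>) \<sigma> = tup ` take 14 ` occurrences \<phi> \<sigma>"
    unfolding members_tup_expr occurrences_def set_vars
    by (subst image_setcompr[where h = "take 14" and g = "\<lambda>\<tau>. map \<tau> bound_vars"])
      (simp_all add: map_bound_vars not_less)
  have 3: "members (Builder (tup_expr bound_vars) bound_vars \<phi>) \<sigma> = tup ` occurrences \<phi> \<sigma>"
    unfolding members_tup_expr occurrences_def set_vars by (simp add: not_less)
  show ?thesis
    unfolding universe_expr_def elems_denot
    by (simp add: 1 2 3 cover_universe_def image_Un Un_assoc del: members.simps)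
qed

text \<open>The predicate \<open>P\<close> on sign and parameter 19 treats the sets for truth and
  for falsity at once.\<close>

lemma denot_fact_expr:
  assumes \<tau>: "\<forall>y. y \<notin> set fact_vars \<longrightarrow> \<tau> y = \<sigma> y"
    and \<psi>: "\<And>\<rho>. sat \<psi> \<rho> \<longleftrightarrow> P (\<rho> 14) (\<rho> 19)"
  shows "denot (fact_expr \<phi> \<psi>) \<tau> = tup_set (insert (map \<tau> fact_vars)
    {v \<in> occurrences \<phi> \<sigma>. drop 15 v = map \<tau> fact_vars \<and> P (v ! 14) (\<sigma> 19)})"
proof -
  have \<rho>: "(\<forall>y. y \<notin> set clause_pol_vars \<longrightarrow> \<rho> y = \<tau> y) \<longleftrightarrow>
      (\<forall>y\<ge>19. \<rho> y = \<sigma> y) \<and> map \<rho> fact_vars = map \<tau> fact_vars" for \<rho>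
    using \<tau> unfolding map_eq_conv set_vars by (auto simp: not_less)
  have "{map \<rho> bound_vars |\<rho>. (\<forall>y. y \<notin> set clause_pol_vars \<longrightarrow> \<rho> y = \<tau> y) \<and> sat (Conj \<phi> \<psi>) \<rho>} =
    {v \<in> occurrences \<phi> \<sigma>. drop 15 v = map \<tau> fact_vars \<and> P (v ! 14) (\<sigma> 19)}"
    unfolding \<rho> occurrences_def by (auto simp: \<psi> map_bound_vars simp del: map_eq_conv)
  then show ?thesis
    unfolding fact_expr_def denot_SetExpr
    by (simp add: members_unit members_tup_expr[of bound_vars] denot_tup_expr tup_set_def del: members.simps)
qed

lemma elems_family_expr:
  "elems (denot (family_expr \<phi>) \<sigma>) = tup_set ` cover_family (occurrences \<phi> \<sigma>) (\<sigma> 19)"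
proof -
  let ?L = "occurrences \<phi> \<sigma>"
  have facts: "members (Builder (fact_expr \<phi> \<psi>) fact_vars Tru) \<sigma> =
      tup_set ` (\<lambda>a. insert a {v \<in> ?L. drop 15 v = a \<and> P (v ! 14) (\<sigma> 19)}) ` {a. length a = 4}"
    if \<psi>: "\<And>\<rho>. sat \<psi> \<rho> \<longleftrightarrow> P (\<rho> 14) (\<rho> 19)" for \<psi> P
    unfolding all_lists_fact_vars[OF subset_refl, of \<sigma>, symmetric] image_image members.simps
    by (subst image_setcompr[symmetric]) (simp_all add: denot_fact_expr[OF _ \<psi>])
  have 1: "members (Builder (fact_expr \<phi> (Neg (Eq 14 19))) fact_vars Tru) \<sigma> =
      tup_set ` tt_set ?L (\<sigma> 19) ` {a. length a = 4}"
    unfolding tt_set_def by (rule facts) simp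
  have 2: "members (Builder (fact_expr \<phi> (Eq 14 19)) fact_vars Tru) \<sigma> =
      tup_set ` ff_set ?L (\<sigma> 19) ` {a. length a = 4}"
    unfolding ff_set_def by (rule facts) simp
  have 3: "members (Builder (SetExpr [Builder (tup_expr clause_vars) [] Tru,
      Builder (tup_expr bound_vars) [] Tru]) bound_vars \<phi>) \<sigma> = tup_set ` (\<lambda>v. {take 14 v, v}) ` ?L"
    unfolding members.simps(1)[of _ bound_vars] occurrences_def set_vars image_image
    by (subst image_setcompr[symmetric])
      (simp_all add: denot_SetExpr members_unit denot_tup_expr tup_set_def map_bound_vars insert_commute not_less
        del: members.simps denot.simps)
  have 4: "members (Builder (SetExpr [Builder (tup_expr bound_vars) [] Tru]) bound_vars \<phi>) \<sigma> =
      tup_set ` (\<lambda>v. {v}) ` ?L"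
    unfolding members.simps(1)[of _ bound_vars] occurrences_def set_vars image_image
    by (subst image_setcompr[symmetric])
      (simp_all add: denot_SetExpr members_unit denot_tup_expr tup_set_def not_less
        del: members.simps denot.simps)
  show ?thesis
    unfolding family_expr_def elems_denot
    by (simp add: 1 2 3 4 cover_family_def image_Un Un_assoc del: members.simps)
qed

lemma set_system_exprs:
  "set_system (denot (universe_expr \<phi>) \<sigma>) (denot (family_expr \<phi>) \<sigma>)"
proof -
  have "is_coll (denot (universe_expr \<phi>) \<sigma>)" "is_coll (denot (family_expr \<phi>) \<sigma>)"
    by (simp_all add: universe_expr_def family_expr_def)
  moreover have "is_coll A \<and> elems A \<subseteq> tup ` cover_universe (occurrences \<phi> \<sigma>)"
    if A: "A \<in> tup_set ` cover_family (occurrences \<phi> \<sigma>) (\<sigma> 19)" for A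
  proof -
    obtain B where B: "A = tup_set B" "B \<in> cover_family (occurrences \<phi> \<sigma>) (\<sigma> 19)"
      using A by (rule imageE)
    have "is_coll A" by (simp add: B(1) tup_set_def)
    moreover have "elems A = tup ` B" unfolding B(1) by (rule elems_tup_set)
    ultimately show ?thesis using image_mono[OF cover_family_subset[OF B(2)], of tup] by simp
  qed
  ultimately show ?thesis
    unfolding set_system_def elems_universe_expr elems_family_expr by blast
qed

text \<open>\<open>R\<close> ranges over arbitrary predicates on facts, matching the fact that
  covers need not be definable.\<close>

lemma has_exact_cover_exprs_iff:
  fixes \<sigma> :: "var \<Rightarrow> 'a::countable"
  shows "has_exact_cover (denot (universe_expr \<phi>) \<sigma>) (denot (family_expr \<phi>) \<sigma>) \<longleftrightarrow>
    (\<exists>R. \<forall>\<tau>. (\<forall>y\<ge>19. \<tau> y = \<sigma> y) \<and> sat \<phi> \<tau> \<longrightarrow>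
      (\<exists>\<rho>. (\<forall>y\<ge>19. \<rho> y = \<sigma> y) \<and> sat \<phi> \<rho> \<and> (\<forall>y<14. \<rho> y = \<tau> y) \<and>
        (R (map \<rho> fact_vars) \<longleftrightarrow> \<rho> 14 = \<sigma> 19)))"
proof -
  have "has_exact_cover (denot (universe_expr \<phi>) \<sigma>) (denot (family_expr \<phi>) \<sigma>) \<longleftrightarrow>
      (\<exists>R. satisfied (occurrences \<phi> \<sigma>) (\<sigma> 19) R)"
    unfolding has_exact_cover_iff[OF elems_universe_expr elems_family_expr]
  proof
    assume "\<exists>T\<subseteq>cover_family (occurrences \<phi> \<sigma>) (\<sigma> 19).
      pairwise disjnt T \<and> \<Union>T = cover_universe (occurrences \<phi> \<sigma>)"
    then obtain T where T: "T \<subseteq> cover_family (occurrences \<phi> \<sigma>) (\<sigma> 19)" "pairwise disjnt T"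
      "\<Union>T = cover_universe (occurrences \<phi> \<sigma>)" by (elim exE conjE)
    show "\<exists>R. satisfied (occurrences \<phi> \<sigma>) (\<sigma> 19) R"
      by (rule exI, rule satisfied_of_cover[OF length_occurrences T])
  qed (elim exE, rule cover_of_satisfied[OF length_occurrences])
  moreover have "satisfied (occurrences \<phi> \<sigma>) (\<sigma> 19) R \<longleftrightarrow>
    (\<forall>\<tau>. (\<forall>y\<ge>19. \<tau> y = \<sigma> y) \<and> sat \<phi> \<tau> \<longrightarrow>
      (\<exists>\<rho>. (\<forall>y\<ge>19. \<rho> y = \<sigma> y) \<and> sat \<phi> \<rho> \<and> map \<rho> clause_vars = map \<tau> clause_vars \<and>
        (R (map \<rho> fact_vars) \<longleftrightarrow> \<rho> 14 = \<sigma> 19)))" for R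
  proof -
    have L: "(\<forall>v\<in>occurrences \<phi> \<sigma>. Q v) \<longleftrightarrow>
        (\<forall>\<tau>. (\<forall>y\<ge>19. \<tau> y = \<sigma> y) \<and> sat \<phi> \<tau> \<longrightarrow> Q (map \<tau> bound_vars))"
      "(\<exists>v\<in>occurrences \<phi> \<sigma>. Q v) \<longleftrightarrow>
        (\<exists>\<tau>. (\<forall>y\<ge>19. \<tau> y = \<sigma> y) \<and> sat \<phi> \<tau> \<and> Q (map \<tau> bound_vars))" for Q
      unfolding occurrences_def by blast+
    show ?thesis unfolding satisfied_def L map_bound_vars by blast
  qed
  moreover have "map \<rho> clause_vars = map \<tau> clause_vars \<longleftrightarrow> (\<forall>y<14. \<rho> y = \<tau> y)"
    for \<rho> \<tau> :: "var \<Rightarrow> 'a"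
    unfolding map_eq_conv set_vars by auto
  ultimately show ?thesis by simp
qed

section \<open>Clauses\<close>

text \<open>Parameter \<open>19 + i\<close> is meant to denote the number \<open>i\<close>. A literal \<open>(k, x, y, z)\<close> consists of
  the index of a ternary relation and of three variables. In \<open>(c, b, l)\<close>, the literal \<open>l\<close> occurs
  in the clause with index \<open>c\<close>, positively iff \<open>b\<close>.\<close>

type_synonym literal = "nat \<times> var \<times> var \<times> var"
type_synonym occurrence = "nat \<times> bool \<times> literal"

text \<open>The numeral parameters double as clause and relation indices; 20 can serve as the
  negative sign because it denotes another atom than 19. Variables 1 to 13 are tied only to the
  fact's arguments, so every choice of their values gives an instance of the clause.\<close>

fun occ_fm :: "occurrence \<Rightarrow> fm" where
  "occ_fm (c, b, k, x, y, z) =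
     Conj (Eq 0 (19 + c)) (Conj (Eq 14 (if b then 19 else 20)) (Conj (Eq 15 (19 + k))
       (Conj (Eq 16 x) (Conj (Eq 17 y) (Eq 18 z)))))"

primrec disj_fm :: "fm list \<Rightarrow> fm" where
  "disj_fm [] = Neg Tru"
| "disj_fm (\<phi> # \<phi>s) = Disj \<phi> (disj_fm \<phi>s)"

lemma sat_disj_fm: "sat (disj_fm \<phi>s) \<tau> \<longleftrightarrow> (\<exists>\<phi>\<in>set \<phi>s. sat \<phi> \<tau>)"
  by (induction \<phi>s) auto

fun holds :: "(nat \<Rightarrow> 'a \<Rightarrow> 'a \<Rightarrow> 'a \<Rightarrow> bool) \<Rightarrow> (var \<Rightarrow> 'a) \<Rightarrow> literal \<Rightarrow> bool" where
  "holds Q \<tau> (k, x, y, z) = Q k (\<tau> x) (\<tau> y) (\<tau> z)"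

definition literal_var :: "var \<Rightarrow> bool" where
  "literal_var x \<longleftrightarrow> 1 \<le> x \<and> x \<le> 13 \<or> 19 \<le> x"

lemma literal_var_neq:
  "literal_var x \<Longrightarrow> x \<noteq> 0 \<and> x \<noteq> 14 \<and> x \<noteq> 15 \<and> x \<noteq> 16 \<and> x \<noteq> 17 \<and> x \<noteq> 18"
  by (auto simp: literal_var_def)

text \<open>Variable \<open>17\<close> in the third place is not constrained by \<open>occ_fm\<close>, so it turns a literal into
  an infinite disjunction over all atoms.\<close>

definition wf_occ :: "occurrence \<Rightarrow> bool" where
  "wf_occ = (\<lambda>(c, b, k, x, y, z). literal_var x \<and> (literal_var y \<or> y = 17) \<and> literal_var z)"

definition clause_true ::
  "occurrence list \<Rightarrow> (nat \<Rightarrow> 'a \<Rightarrow> 'a \<Rightarrow> 'a \<Rightarrow> bool) \<Rightarrow> (var \<Rightarrow> 'a) \<Rightarrow> nat \<Rightarrow> bool" where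
  "clause_true os Q \<tau> c \<longleftrightarrow> (\<exists>w b l. (c, b, l) \<in> set os \<and> (holds Q (\<tau>(17 := w)) l \<longleftrightarrow> b))"

lemma map_fact_vars: "map \<tau> fact_vars = [\<tau> 15, \<tau> 16, \<tau> 17, \<tau> 18]"
  by (simp add: fact_vars_def)

text \<open>Occurrences and literals under a valuation determine each other: the positions fixed by
  \<open>occ_fm\<close> are disjoint from those allowed in a literal, apart from 17, and injectivity
  on parameters keeps different clauses apart.\<close>

lemma has_exact_cover_iff_clauses:
  fixes \<sigma> :: "var \<Rightarrow> 'a::countable" and os :: "occurrence list"
  defines "\<phi> \<equiv> disj_fm (map occ_fm os)"
  assumes inj: "\<And>i j. \<sigma> (19 + i) = \<sigma> (19 + j) \<Longrightarrow> i = j" and wf: "\<And>oc. oc \<in> set os \<Longrightarrow> wf_occ oc"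
  shows "has_exact_cover (denot (universe_expr \<phi>) \<sigma>) (denot (family_expr \<phi>) \<sigma>) \<longleftrightarrow>
    (\<exists>R. \<forall>\<tau>. (\<forall>y\<ge>19. \<tau> y = \<sigma> y) \<longrightarrow> (\<forall>c\<in>fst ` set os.
       clause_true os (\<lambda>k x y z. R [\<sigma> (19 + k), x, y, z]) \<tau> c))"
  (is "_ \<longleftrightarrow> (\<exists>R. ?clauses R)")
proof -
  have \<sigma>01: "\<sigma> 20 \<noteq> \<sigma> 19" using inj[of 1 0] by auto
  have sat: "sat \<phi> \<tau> \<longleftrightarrow> (\<exists>oc\<in>set os. sat (occ_fm oc) \<tau>)" for \<tau> :: "var \<Rightarrow> 'a"
    by (simp add: \<phi>_def sat_disj_fm)
  let ?sat = "\<lambda>R. \<forall>\<tau>. (\<forall>y\<ge>19. \<tau> y = \<sigma> y) \<and> sat \<phi> \<tau> \<longrightarrow>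
      (\<exists>\<rho>. (\<forall>y\<ge>19. \<rho> y = \<sigma> y) \<and> sat \<phi> \<rho> \<and> (\<forall>y<14. \<rho> y = \<tau> y) \<and>
        (R (map \<rho> fact_vars) \<longleftrightarrow> \<rho> 14 = \<sigma> 19))"
  have 1: "?clauses R" if R: "?sat R" for R
  proof (intro allI impI ballI)
    fix \<tau> c assume \<tau>: "\<forall>y\<ge>19. \<tau> y = \<sigma> y" and "c \<in> fst ` set os"
    then obtain b k x y z where oc: "(c, b, k, x, y, z) \<in> set os" by auto
    have wfo: "literal_var x" "literal_var y \<or> y = 17" "literal_var z"
      using wf[OF oc] by (simp_all add: wf_occ_def)
    \<comment> \<open>Turn the literal into an occurrence by overwriting just the positions that
      \<open>occ_fm\<close> mentions.\<close>
    let ?\<tau> = "\<tau>(0 := \<sigma> (19 + c), 14 := (if b then \<sigma> 19 else \<sigma> 20), 15 := \<sigma> (19 + k),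
      16 := \<tau> x, 17 := \<tau> y, 18 := \<tau> z)"
    have "?\<tau> x = \<tau> x" "?\<tau> z = \<tau> z"
      using wfo(1,3)[THEN literal_var_neq] by simp_all
    moreover have "?\<tau> y = \<tau> y"
      using wfo(2) by (elim disjE) (simp_all add: literal_var_neq)
    ultimately have "sat (occ_fm (c, b, k, x, y, z)) ?\<tau>" using \<tau> by simp
    then have "sat \<phi> ?\<tau>" using oc sat by blast
    moreover have "\<forall>y\<ge>19. ?\<tau> y = \<sigma> y" using \<tau> by simp
    ultimately obtain \<rho> where \<rho>: "\<forall>y\<ge>19. \<rho> y = \<sigma> y" "sat \<phi> \<rho>" "\<forall>y<14. \<rho> y = ?\<tau> y"
      "R (map \<rho> fact_vars) \<longleftrightarrow> \<rho> 14 = \<sigma> 19"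
      using R by blast
    from \<rho>(2) obtain c' b' k' x' y' z' where oc': "(c', b', k', x', y', z') \<in> set os"
      "sat (occ_fm (c', b', k', x', y', z')) \<rho>"
      unfolding sat by auto
    have "\<rho> 0 = \<sigma> (19 + c)" using \<rho>(3) by simp
    then have "c' = c" using oc'(2) \<rho>(1) inj by simp
    have wfo': "literal_var x'" "literal_var y' \<or> y' = 17" "literal_var z'"
      using wf[OF oc'(1)] by (simp_all add: wf_occ_def)
    \<comment> \<open>The witness found may differ from \<open>\<tau>\<close> at 17; taking this
      value over gives the \<open>w\<close> of \<open>clause_true\<close>.\<close>
    have eq: "(\<tau>(17 := \<rho> 17)) u = \<rho> u" if "literal_var u \<or> u = 17" for u
      using that \<rho>(1,3) \<tau> by (auto simp: literal_var_def)
    have "(\<tau>(17 := \<rho> 17)) x' = \<rho> x'" "(\<tau>(17 := \<rho> 17)) y' = \<rho> y'" "(\<tau>(17 := \<rho> 17)) z' = \<rho> z'"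
      using wfo' by (blast intro: eq)+
    then    have "holds (\<lambda>k x y z. R [\<sigma> (19 + k), x, y, z]) (\<tau>(17 := \<rho> 17)) (k', x', y', z') \<longleftrightarrow>
        R (map \<rho> fact_vars)"
      using oc'(2) \<rho>(1) by (simp add: map_fact_vars del: fun_upd_apply)
    also have "\<dots> \<longleftrightarrow> b'" using \<rho>(4) oc'(2) \<rho>(1) \<sigma>01 by (auto split: if_splits)
    finally show "clause_true os (\<lambda>k x y z. R [\<sigma> (19 + k), x, y, z]) \<tau> c"
      using oc'(1) \<open>c' = c\<close> unfolding clause_true_def by blast
  qed
  have 2: "?sat R" if R: "?clauses R" for R
  proof (intro allI impI; elim conjE)
    fix \<tau> assume \<tau>: "\<forall>y\<ge>19. \<tau> y = \<sigma> y" and "sat \<phi> \<tau>"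
    then obtain c b k x y z where oc: "(c, b, k, x, y, z) \<in> set os"
      "sat (occ_fm (c, b, k, x, y, z)) \<tau>"
      unfolding sat by auto
    have "c \<in> fst ` set os" using oc(1) by force
    then obtain w b' k' x' y' z' where oc': "(c, b', k', x', y', z') \<in> set os"
      "holds (\<lambda>k x y z. R [\<sigma> (19 + k), x, y, z]) (\<tau>(17 := w)) (k', x', y', z') \<longleftrightarrow> b'"
      using R \<tau> unfolding clause_true_def by (metis prod_cases4)
    let ?\<tau> = "\<tau>(17 := w)"
    let ?\<rho> = "?\<tau>(14 := (if b' then \<sigma> 19 else \<sigma> 20), 15 := \<sigma> (19 + k'),
      16 := ?\<tau> x', 17 := ?\<tau> y', 18 := ?\<tau> z')"
    have wfo': "literal_var x'" "literal_var y' \<or> y' = 17" "literal_var z'"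
      using wf[OF oc'(1)] by (simp_all add: wf_occ_def)
    have "?\<rho> x' = ?\<tau> x'" "?\<rho> z' = ?\<tau> z'"
      using wfo'(1,3)[THEN literal_var_neq] by simp_all
    moreover have "?\<rho> y' = ?\<tau> y'"
      using wfo'(2) by (elim disjE) (simp_all add: literal_var_neq)
    ultimately have "sat (occ_fm (c, b', k', x', y', z')) ?\<rho>" using \<tau> oc(2) by simp
    then have "sat \<phi> ?\<rho>" using oc'(1) sat by blast
    moreover have "\<forall>y\<ge>19. ?\<rho> y = \<sigma> y" using \<tau> by simp
    moreover have "\<forall>y<14. ?\<rho> y = \<tau> y" by simp
    moreover have "R (map ?\<rho> fact_vars) \<longleftrightarrow> ?\<rho> 14 = \<sigma> 19"
      using oc'(2) \<sigma>01 by (simp add: map_fact_vars)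
    ultimately show "\<exists>\<rho>. (\<forall>y\<ge>19. \<rho> y = \<sigma> y) \<and> sat \<phi> \<rho> \<and> (\<forall>y<14. \<rho> y = \<tau> y) \<and>
        (R (map \<rho> fact_vars) \<longleftrightarrow> \<rho> 14 = \<sigma> 19)" by blast
  qed
  show ?thesis
    unfolding has_exact_cover_exprs_iff
    by (intro iff_exI iffI) (erule 1, erule 2)
qed

section \<open>Horn rules for recursive functions\<close>

text \<open>The \<open>Suc\<close> makes this the step of \<open>list_encode\<close>, so a single
  relation takes apart both argument lists and program codes.\<close>

definition cons_code :: "nat \<Rightarrow> nat \<Rightarrow> nat" where
  "cons_code x y = Suc (prod_encode (x, y))"

lemma list_encode_Cons: "list_encode (x # xs) = cons_code x (list_encode xs)"
  by (simp add: cons_code_def)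

lemma cons_code_inject [simp]: "cons_code x y = cons_code x' y' \<longleftrightarrow> x = x' \<and> y = y'"
  by (simp add: cons_code_def)

lemma list_decode_cons_code [simp]: "list_decode (cons_code x l) = x # list_decode l"
  by (simp add: cons_code_def)

text \<open>The pairing function walks along antidiagonals, and each step adds 1 to the code. This
  defines its graph from successor alone, without addition, by the three Horn rules for
  \<open>cons_lit\<close>.\<close>

lemma cons_code_rec:
  "cons_code 0 0 = 1"
  "cons_code (Suc x) y = Suc (cons_code x (Suc y))"
  "cons_code 0 (Suc x) = Suc (cons_code x 0)"
  by (simp_all add: cons_code_def prod_encode_def)

text \<open>The constructor tags 0 to 5 are the constants 19 to 24 in the rules.\<close>

fun recf_code :: "recf \<Rightarrow> nat" where
  "recf_code Zero = cons_code 0 0"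
| "recf_code Succ = cons_code 1 0"
| "recf_code (Proj i) = cons_code 2 i"
| "recf_code (Comp f gs) = cons_code 3 (cons_code (recf_code f) (list_encode (map recf_code gs)))"
| "recf_code (PrimRec f g) = cons_code 4 (cons_code (recf_code f) (recf_code g))"
| "recf_code (Mu f) = cons_code 5 (recf_code f)"

lemma cons_code_gt: "x < cons_code x y"
  using le_prod_encode_1[of x y] by (simp add: cons_code_def)

abbreviation (input) "suc_lit x y \<equiv> (0, x, y, 19) :: literal"
abbreviation (input) "cons_lit x y z \<equiv> (1, x, y, z) :: literal"
abbreviation (input) "computes_lit f l y \<equiv> (2, f, l, y) :: literal"
abbreviation (input) "map_lit gs l ys \<equiv> (3, gs, l, ys) :: literal"
abbreviation (input) "min_lit f l n \<equiv> (4, f, l, n) :: literal"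
abbreviation (input) "nth_lit i l y \<equiv> (5, i, l, y) :: literal"

text \<open>The rules mirror those of \<open>computes\<close>. In \<open>map_lit gs l ys\<close> the list \<open>ys\<close> has the values of
  the functions \<open>gs\<close> at \<open>l\<close>; \<open>min_lit f l n\<close> says that \<open>f\<close> has positive values at \<open>i # l\<close>
  for all \<open>i < n\<close>. The first rule is the totality of the successor relation.\<close>

definition rules :: "(literal list \<times> literal list) list" where
  "rules = [
    ([], [suc_lit 1 17]),
    ([suc_lit 19 1], [cons_lit 19 19 1]),
    ([cons_lit 1 4 5, suc_lit 1 2, suc_lit 3 4, suc_lit 5 6], [cons_lit 2 3 6]),
    ([cons_lit 1 19 3, suc_lit 1 2, suc_lit 3 4], [cons_lit 19 2 4]),
    ([cons_lit 19 19 1], [computes_lit 1 2 19]),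
    ([cons_lit 20 19 1, cons_lit 2 19 3, suc_lit 2 4], [computes_lit 1 3 4]),
    ([cons_lit 21 2 1, nth_lit 2 3 4], [computes_lit 1 3 4]),
    ([cons_lit 1 2 3], [nth_lit 19 3 1]),
    ([suc_lit 1 2, cons_lit 3 4 5, nth_lit 1 4 6], [nth_lit 2 5 6]),
    ([cons_lit 22 2 1, cons_lit 3 4 2, map_lit 4 5 6, computes_lit 3 6 7], [computes_lit 1 5 7]),
    ([], [map_lit 19 1 19]),
    ([cons_lit 1 2 3, cons_lit 4 5 6, computes_lit 1 7 4, map_lit 2 7 5], [map_lit 3 7 6]),
    ([cons_lit 23 2 1, cons_lit 3 4 2, cons_lit 19 5 6, computes_lit 3 5 7], [computes_lit 1 6 7]),
    ([cons_lit 23 2 1, cons_lit 3 4 2, cons_lit 5 7 8, suc_lit 5 6, cons_lit 6 7 9,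
      computes_lit 1 8 10, cons_lit 10 7 11, cons_lit 5 11 12, computes_lit 4 12 13],
     [computes_lit 1 9 13]),
    ([cons_lit 24 2 1, min_lit 2 3 4, cons_lit 4 3 5, computes_lit 2 5 19], [computes_lit 1 3 4]),
    ([], [min_lit 1 2 19]),
    ([suc_lit 3 4, min_lit 1 2 3, cons_lit 3 2 5, suc_lit 6 7, computes_lit 1 5 7],
     [min_lit 1 2 4])]"

definition rule_true :: "(nat \<Rightarrow> 'a \<Rightarrow> 'a \<Rightarrow> 'a \<Rightarrow> bool) \<Rightarrow> (var \<Rightarrow> 'a) \<Rightarrow> nat \<Rightarrow> bool" where
  "rule_true Q \<tau> c \<longleftrightarrow> (\<exists>w. (\<forall>l\<in>set (fst (rules ! c)). holds Q (\<tau>(17 := w)) l) \<longrightarrow>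
     (\<exists>l\<in>set (snd (rules ! c)). holds Q (\<tau>(17 := w)) l))"

lemma less_17_cases:
  assumes "c < (17::nat)"
    "P 0" "P 1" "P 2" "P 3" "P 4" "P 5" "P 6" "P 7" "P 8" "P 9" "P 10" "P 11" "P 12" "P 13" "P 14"
    "P 15" "P 16"
  shows "P c"
  using assms by (auto simp: less_Suc_eq numeral_eq_Suc)

text \<open>\<open>num\<close> is a walk along the successor relation of an arbitrary model; it may
  repeat atoms, but it must start with the constants used as constructor tags.\<close>

locale rule_model =
  fixes Q :: "nat \<Rightarrow> 'a \<Rightarrow> 'a \<Rightarrow> 'a \<Rightarrow> bool" and \<sigma> :: "var \<Rightarrow> 'a" and num :: "nat \<Rightarrow> 'a"
  assumes rule: "\<And>c \<tau>. c < 17 \<Longrightarrow> (\<forall>y\<ge>19. \<tau> y = \<sigma> y) \<Longrightarrow> rule_true Q \<tau> c"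
    and num_const: "\<And>i. i \<le> 5 \<Longrightarrow> num i = \<sigma> (19 + i)"
    and num_Suc: "\<And>n. Q 0 (num n) (num (Suc n)) (\<sigma> 19)"
begin

lemma const_nums: "\<sigma> 19 = num 0" "\<sigma> 20 = num 1" "\<sigma> 21 = num 2" "\<sigma> 22 = num 3" "\<sigma> 23 = num 4" "\<sigma> 24 = num 5"
  using num_const[of 0] num_const[of 1] num_const[of 2] num_const[of 3] num_const[of 4] num_const[of 5]
  by simp_all

text \<open>Apart from rule 0 no rule mentions variable 17, so values \<open>v\<close> for the first
  14 variables determine the instance.\<close>

lemma instance_rule:
  assumes "c < 17" "c \<noteq> 0"
  shows "(\<forall>l\<in>set (fst (rules ! c)). holds Q (\<lambda>y. if y < 14 then v y else \<sigma> y) l) \<longrightarrow>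
     (\<exists>l\<in>set (snd (rules ! c)). holds Q (\<lambda>y. if y < 14 then v y else \<sigma> y) l)"
proof -
  have "rule_true Q (\<lambda>y. if y < 14 then v y else \<sigma> y) c \<longrightarrow> c \<noteq> 0 \<longrightarrow> ?thesis"
    by (rule less_17_cases[OF assms(1)]) (simp_all add: rule_true_def rules_def)
  then show ?thesis using rule[of c "\<lambda>y. if y < 14 then v y else \<sigma> y"] assms by simp
qed

text \<open>Every recursive step of \<open>cons_code_rec\<close> refers to the code one smaller,
  hence the induction on the code.\<close>

lemma cons: "Q 1 (num x) (num y) (num (cons_code x y))"
proof (induction "cons_code x y" arbitrary: x y rule: less_induct)
  case less
  consider "x = 0" "y = 0" | x' where "x = Suc x'" | y' where "x = 0" "y = Suc y'"
    by (metis not0_implies_Suc)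
  then show ?case
  proof cases
    case 1
    then show ?thesis
      using instance_rule[of 1 "\<lambda>_. num 1"] num_Suc[of 0]
      by (simp add: rules_def cons_code_rec const_nums)
  next
    case 2
    \<comment> \<open>Entry \<open>i\<close> of the list is the value of rule variable
      \<open>i\<close>; entry 0 is a filler, as rule variables start at 1.\<close>
    then show ?thesis
      using instance_rule[of 2 "(!) [num 0, num x', num x, num y, num (Suc y), num (cons_code x' (Suc y)), num (cons_code x y)]"]
        less[of x' "Suc y"] num_Suc
      by (simp add: rules_def cons_code_rec const_nums)
  next
    case 3
    then show ?thesis
      using instance_rule[of 3 "(!) [num 0, num y', num y, num (cons_code y' 0), num (cons_code x y)]"]
        less[of y' 0] num_Suc
      by (simp add: rules_def cons_code_rec const_nums)
  qed
qed

lemma nth: "i < length xs \<Longrightarrow> Q 5 (num i) (num (list_encode xs)) (num (xs ! i))"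
proof (induction xs arbitrary: i)
  case (Cons x xs)
  show ?case
  proof (cases i)
    case 0
    then show ?thesis
      using instance_rule[of 7 "(!) [num 0, num x, num (list_encode xs), num (list_encode (x # xs))]"]
        cons[of x "list_encode xs"]
      by (simp add: rules_def const_nums list_encode_Cons del: list_encode.simps)
  next
    case (Suc j)
    then show ?thesis
      using instance_rule[of 8 "(!) [num 0, num j, num i, num x, num (list_encode xs),
          num (list_encode (x # xs)), num (xs ! j)]"]
        cons[of x "list_encode xs"] Cons num_Suc[of j]
      by (simp add: rules_def const_nums list_encode_Cons del: list_encode.simps)
  qed
qed simp

lemma computes: "computes f xs y \<Longrightarrow> Q 2 (num (recf_code f)) (num (list_encode xs)) (num y)"
proof (induction rule: computes.induct)
  case (Zero xs)
  show ?case
    using instance_rule[of 4 "(!) [num 0, num (recf_code Zero), num (list_encode xs)]"] cons[of 0 0]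
    by (simp add: rules_def const_nums)
next
  case (Succ x)
  show ?case
    using instance_rule[of 5 "(!) [num 0, num (recf_code Succ), num x, num (list_encode [x]), num (Suc x)]"]
      cons[of 1 0] cons[of x 0] num_Suc[of x]
    by (simp add: rules_def const_nums cons_code_def)
next
  case (Proj i xs)
  show ?case
    using instance_rule[of 6 "(!) [num 0, num (recf_code (Proj i)), num i, num (list_encode xs), num (xs ! i)]"]
      cons[of 2 i] nth[OF Proj]
    by (simp add: rules_def const_nums)
next
  case (Comp xs gs ys f z)
  have "Q 3 (num (list_encode (map recf_code gs))) (num (list_encode xs)) (num (list_encode ys))"
    using Comp.IH(1)
  proof (induction rule: list_all2_induct)
    case Nil
    show ?case
      using instance_rule[of 10 "(!) [num 0, num (list_encode xs)]"] by (simp add: rules_def const_nums)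
  next
    case (Cons g gs y ys)
    then show ?case
      using instance_rule[of 11 "(!) [num 0, num (recf_code g), num (list_encode (map recf_code gs)),
          num (list_encode (map recf_code (g # gs))), num y, num (list_encode ys),
          num (list_encode (y # ys)), num (list_encode xs)]"]
        cons[of "recf_code g" "list_encode (map recf_code gs)"] cons[of y "list_encode ys"]
      by (simp add: rules_def const_nums list_encode_Cons del: list_encode.simps(2))
  qed
  then show ?case
    using instance_rule[of 9 "(!) [num 0, num (recf_code (Comp f gs)),
        num (cons_code (recf_code f) (list_encode (map recf_code gs))), num (recf_code f),
        num (list_encode (map recf_code gs)), num (list_encode xs), num (list_encode ys), num z]"]
      Comp.IH(2) cons[of "recf_code f" "list_encode (map recf_code gs)"]
      cons[of 3 "cons_code (recf_code f) (list_encode (map recf_code gs))"]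
    by (simp add: rules_def const_nums)
next
  case (PrimRec_0 f xs y g)
  then show ?case
    using instance_rule[of 12 "(!) [num 0, num (recf_code (PrimRec f g)),
        num (cons_code (recf_code f) (recf_code g)), num (recf_code f), num (recf_code g),
        num (list_encode xs), num (list_encode (0 # xs)), num y]"]
      cons[of "recf_code f" "recf_code g"] cons[of 4 "cons_code (recf_code f) (recf_code g)"]
      cons[of 0 "list_encode xs"]
    by (simp add: rules_def const_nums list_encode_Cons del: list_encode.simps(2))
next
  case (PrimRec_Suc f g n xs r y)
  then show ?case
    using instance_rule[of 13 "(!) [num 0, num (recf_code (PrimRec f g)),
        num (cons_code (recf_code f) (recf_code g)), num (recf_code f), num (recf_code g),
        num n, num (Suc n), num (list_encode xs), num (list_encode (n # xs)),
        num (list_encode (Suc n # xs)), num r, num (list_encode (r # xs)),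
        num (list_encode (n # r # xs)), num y]"]
      cons[of "recf_code f" "recf_code g"] cons[of 4 "cons_code (recf_code f) (recf_code g)"]
      cons[of n "list_encode xs"] cons[of "Suc n" "list_encode xs"] cons[of r "list_encode xs"]
      cons[of n "list_encode (r # xs)"] num_Suc[of n]
    by (simp add: rules_def const_nums list_encode_Cons del: list_encode.simps(2))
next
  case (Mu f n xs)
  \<comment> \<open>The bounded universal premise of \<open>computes.Mu\<close> is not Horn;
    \<open>min_lit\<close> collects it index by index.\<close>
  have "Q 4 (num (recf_code f)) (num (list_encode xs)) (num i)" if "i \<le> n" for i
    using that
  proof (induction i)
    case 0
    show ?case
      using instance_rule[of 15 "(!) [num 0, num (recf_code f), num (list_encode xs)]"]
      by (simp add: rules_def const_nums)
  next
    case (Suc i)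
    then obtain k where "Q 2 (num (recf_code f)) (num (list_encode (i # xs))) (num (Suc k))"
      using Mu.IH(2)[of i] by auto
    then show ?case
      using instance_rule[of 16 "(!) [num 0, num (recf_code f), num (list_encode xs), num i,
          num (Suc i), num (list_encode (i # xs)), num k, num (Suc k)]"] Suc
        cons[of i "list_encode xs"] num_Suc[of i] num_Suc[of k]
      by (simp add: rules_def const_nums list_encode_Cons del: list_encode.simps(2))
  qed
  then show ?case
    using instance_rule[of 14 "(!) [num 0, num (recf_code (Mu f)), num (recf_code f),
        num (list_encode xs), num n, num (list_encode (n # xs))]"] Mu.IH(1)
      cons[of 5 "recf_code f"] cons[of n "list_encode xs"]
    by (simp add: rules_def const_nums list_encode_Cons del: list_encode.simps(2))
qed

end

section \<open>The standard model\<close>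

lemma cons_code_neq_0 [simp]: "cons_code x y \<noteq> 0"
  by (simp add: cons_code_def)

text \<open>A version of \<open>computes\<close> on codes, with \<open>map_rel\<close> and
  \<open>min_rel\<close> replacing its quantified premises, so that the introduction rules match the
  Horn rules literally. As these apply to all atoms, it is defined on all numbers, not only on codes
  of programs.\<close>

inductive comp_rel :: "nat \<Rightarrow> nat \<Rightarrow> nat \<Rightarrow> bool"
  and map_rel :: "nat \<Rightarrow> nat \<Rightarrow> nat \<Rightarrow> bool"
  and min_rel :: "nat \<Rightarrow> nat \<Rightarrow> nat \<Rightarrow> bool" where
  Zero: "comp_rel (cons_code 0 0) l 0"
| Succ: "comp_rel (cons_code 1 0) (cons_code x 0) (Suc x)"
| Proj: "i < length (list_decode l) \<Longrightarrow> comp_rel (cons_code 2 i) l (list_decode l ! i)"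
| Comp: "map_rel gs l ys \<Longrightarrow> comp_rel f ys z \<Longrightarrow>
    comp_rel (cons_code 3 (cons_code f gs)) l z"
| Nil: "map_rel 0 l 0"
| Cons: "comp_rel g l y \<Longrightarrow> map_rel gs l ys \<Longrightarrow> map_rel (cons_code g gs) l (cons_code y ys)"
| PrimRec_0: "comp_rel f xs y \<Longrightarrow> comp_rel (cons_code 4 (cons_code f g)) (cons_code 0 xs) y"
| PrimRec_Suc: "comp_rel (cons_code 4 (cons_code f g)) (cons_code n xs) r \<Longrightarrow>
    comp_rel g (cons_code n (cons_code r xs)) y \<Longrightarrow>
    comp_rel (cons_code 4 (cons_code f g)) (cons_code (Suc n) xs) y"
| Mu: "min_rel f xs n \<Longrightarrow> comp_rel f (cons_code n xs) 0 \<Longrightarrow> comp_rel (cons_code 5 f) xs n"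
| min_0: "min_rel f xs 0"
| min_Suc: "min_rel f xs n \<Longrightarrow> comp_rel f (cons_code n xs) (Suc k) \<Longrightarrow> min_rel f xs (Suc n)"

text \<open>Every number decodes to a list, so only the program argument has to be a code. With
  \<open>f\<close> arbitrary, the tags reveal its constructor and the induction hypotheses apply to
  the subprograms.\<close>

lemma comp_rel_sound:
  "comp_rel p l y \<Longrightarrow> p = recf_code f \<Longrightarrow> computes f (list_decode l) y"
  "map_rel gs l ys \<Longrightarrow> gs = list_encode (map recf_code fs) \<Longrightarrow>
     list_all2 (\<lambda>g y. computes g (list_decode l) y) fs (list_decode ys)"
  "min_rel p l n \<Longrightarrow> p = recf_code f \<Longrightarrow> \<forall>m<n. \<exists>k. computes f (m # list_decode l) (Suc k)"
proof (induction arbitrary: f and fs and f rule: comp_rel_map_rel_min_rel.inducts)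
  case (Zero l)
  then show ?case by (cases f) (auto intro: computes.Zero)
next
  case (Succ x)
  then show ?case by (cases f) (auto intro: computes.Succ)
next
  case (Proj i l)
  then show ?case by (cases f) (auto intro: computes.Proj)
next
  case (Comp gs l ys f z h)
  then show ?case by (cases h) (auto intro: computes.Comp)
next
  case (Nil l)
  then show ?case by (cases fs) auto
next
  case (Cons g l y gs ys)
  then show ?case by (cases fs) (auto simp: list_encode_Cons simp del: list_encode.simps(2))
next
  case (PrimRec_0 f xs y g h)
  then show ?case by (cases h) (auto intro: computes.PrimRec_0)
next
  case (PrimRec_Suc f g n xs r y h)
  then obtain f' g' where h: "h = PrimRec f' g'" "f = recf_code f'" "g = recf_code g'"
    by (cases h) auto
  show ?case
    using PrimRec_Suc.IH(1)[of h] PrimRec_Suc.IH(2)[of g'] by (auto simp: h intro: computes.PrimRec_Suc)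
next
  case (Mu f xs n h)
  then show ?case by (cases h) (auto intro: computes.Mu)
next
  case (min_0 f xs)
  then show ?case by simp
next
  case (min_Suc f xs n k h)
  then show ?case by (auto simp: less_Suc_eq)
qed

definition std_rel :: "nat \<Rightarrow> nat \<Rightarrow> nat \<Rightarrow> nat \<Rightarrow> bool" where
  "std_rel k x y z = [y = Suc x, z = cons_code x y, comp_rel x y z, map_rel x y z, min_rel x y z,
     x < length (list_decode y) \<and> z = list_decode y ! x] ! k"

lemma std_rel_simps [simp]:
  "std_rel 0 x y z \<longleftrightarrow> y = Suc x"
  "std_rel (Suc 0) x y z \<longleftrightarrow> z = cons_code x y"
  "std_rel 2 x y z \<longleftrightarrow> comp_rel x y z"
  "std_rel 3 x y z \<longleftrightarrow> map_rel x y z"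
  "std_rel 4 x y z \<longleftrightarrow> min_rel x y z"
  "std_rel 5 x y z \<longleftrightarrow> x < length (list_decode y) \<and> z = list_decode y ! x"
  by (simp_all add: std_rel_def)

text \<open>The rules become introduction rules or recursion equations; for rule 0 the value of
  variable 17 is the successor.\<close>

lemma std_rel_rules:
  assumes "c < 17" and v: "v 19 = 0" "v 20 = 1" "v 21 = 2" "v 22 = 3" "v 23 = 4" "v 24 = 5"
  shows "rule_true std_rel v c"
  unfolding rule_true_def
  by (rule less_17_cases[OF \<open>c < 17\<close>])
    (auto simp: rules_def v intro: comp_rel_map_rel_min_rel.intros[unfolded One_nat_def],
      simp_all add: cons_code_rec)

section \<open>Clauses for the run of a program on its own code\<close>

definition clause_of_rule :: "nat \<Rightarrow> literal list \<times> literal list \<Rightarrow> occurrence list" where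
  "clause_of_rule c r = map (\<lambda>l. (c, False, l)) (fst r) @ map (\<lambda>l. (c, True, l)) (snd r)"

definition rule_occs :: "occurrence list" where
  "rule_occs = concat (map (\<lambda>c. clause_of_rule c (rules ! c)) [0..<17])"

text \<open>Unit clauses that make parameters 19 to \<open>19 + m\<close> consecutive in every
  model. They tie the names of the tags and of the program to the numbers meant.\<close>

primrec chain_occs :: "nat \<Rightarrow> occurrence list" where
  "chain_occs 0 = rule_occs"
| "chain_occs (Suc i) = (18 + i, True, suc_lit (19 + i) (20 + i)) # chain_occs i"

text \<open>Clause 17 has two negative literals: the first makes variable 1 a code of the list
  \<open>[m]\<close>, the second excludes every result, held by variable 2.\<close>

definition program_occs :: "nat \<Rightarrow> occurrence list" where
  "program_occs m = (17, False, cons_lit (19 + m) 19 1) # (17, False, computes_lit (19 + m) 1 2) #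
     chain_occs m"

lemma clause_of_rule_iff:
  "(c', b, l) \<in> set (clause_of_rule c r) \<longleftrightarrow> c' = c \<and> l \<in> set (if b then snd r else fst r)"
  by (cases b) (auto simp: clause_of_rule_def)

lemma rule_occs_iff:
  "(c, b, l) \<in> set rule_occs \<longleftrightarrow>
     c < 17 \<and> l \<in> set (if b then snd (rules ! c) else fst (rules ! c))"
  by (simp add: rule_occs_def clause_of_rule_iff del: upt_rec_numeral)

lemma chain_occs_iff:
  "oc \<in> set (chain_occs m) \<longleftrightarrow>
     oc \<in> set rule_occs \<or> (\<exists>i<m. oc = (18 + i, True, suc_lit (19 + i) (20 + i)))"
  by (induction m) (auto simp: less_Suc_eq)

lemma program_occs_rule:
  "c < 17 \<Longrightarrow> (c, b, l) \<in> set (program_occs m) \<longleftrightarrow> l \<in> set (if b then snd (rules ! c) else fst (rules ! c))"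
  by (auto simp: program_occs_def chain_occs_iff rule_occs_iff)

lemma program_occs_goal:
  "(17, b, l) \<in> set (program_occs m) \<longleftrightarrow>
     \<not> b \<and> (l = cons_lit (19 + m) 19 1 \<or> l = computes_lit (19 + m) 1 2)"
  by (auto simp: program_occs_def chain_occs_iff rule_occs_iff)

lemma program_occs_chain:
  "(18 + i, b, l) \<in> set (program_occs m) \<longleftrightarrow> i < m \<and> b \<and> l = suc_lit (19 + i) (20 + i)"
  by (auto simp: program_occs_def chain_occs_iff rule_occs_iff)

lemma rule_nonempty: "c < 17 \<Longrightarrow> snd (rules ! c) \<noteq> []"
  by (erule less_17_cases) (simp_all add: rules_def)

lemma tag_cases:
  fixes c m :: nat
  assumes "c < 18 + m"
  obtains "c < 17" | "c = 17" | i where "i < m" "c = 18 + i"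
proof -
  consider "c < 17" | "c = 17" | "18 \<le> c" by linarith
  then show thesis by cases (use that assms in \<open>auto dest: le_Suc_ex\<close>)
qed

text \<open>The absence of gaps makes the parameters of the formula an interval, which is then the
  domain of the valuation.\<close>

lemma tags_program_occs: "fst ` set (program_occs m) = {..<18 + m}"
proof (intro equalityI subsetI)
  fix c assume "c \<in> {..<18 + m}"
  then have "c < 18 + m" by simp
  then have "\<exists>b l. (c, b, l) \<in> set (program_occs m)"
  proof (cases rule: tag_cases)
    case 1
    then show ?thesis
      using rule_nonempty[OF 1] program_occs_rule[OF 1, of True _ m] by (meson hd_in_set)
  qed (use program_occs_goal program_occs_chain in blast)+
  then show "c \<in> fst ` set (program_occs m)" by force
qed (auto simp: program_occs_def chain_occs_iff rule_occs_iff)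

lemma wf_rules: "c < 17 \<Longrightarrow> l \<in> set (fst (rules ! c)) \<union> set (snd (rules ! c)) \<Longrightarrow> wf_occ (c, b, l)"
proof -
  assume "c < 17"
  then have "\<forall>l \<in> set (fst (rules ! c)) \<union> set (snd (rules ! c)). wf_occ (c, b, l)"
    by (rule less_17_cases) (simp_all add: rules_def wf_occ_def literal_var_def)
  then show "l \<in> set (fst (rules ! c)) \<union> set (snd (rules ! c)) \<Longrightarrow> wf_occ (c, b, l)" by blast
qed

lemma wf_program_occs: "oc \<in> set (program_occs m) \<Longrightarrow> wf_occ oc"
proof -
  assume "oc \<in> set (program_occs m)"
  then consider "oc \<in> set rule_occs" | "oc = (17, False, cons_lit (19 + m) 19 1)"
    | "oc = (17, False, computes_lit (19 + m) 1 2)"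
    | i where "oc = (18 + i, True, suc_lit (19 + i) (20 + i))"
    by (auto simp: program_occs_def chain_occs_iff)
  then show "wf_occ oc"
  proof cases
    case 1
    obtain c b l where "oc = (c, b, l)" by (rule prod_cases3)
    then show ?thesis using 1 wf_rules[of c l b] by (auto simp: rule_occs_iff split: if_splits)
  qed (simp_all add: wf_occ_def literal_var_def)
qed

lemma clause_true_iff:
  "clause_true os Q \<tau> c \<longleftrightarrow>
     (\<exists>w. (\<exists>l. (c, True, l) \<in> set os \<and> holds Q (\<tau>(17 := w)) l) \<or>
          (\<exists>l. (c, False, l) \<in> set os \<and> \<not> holds Q (\<tau>(17 := w)) l))"
  by (simp only: clause_true_def ex_bool_eq simp_thms)

lemma clause_true_rule:
  assumes "c < 17"
  shows "clause_true (program_occs m) Q \<tau> c \<longleftrightarrow> rule_true Q \<tau> c"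
  unfolding clause_true_iff rule_true_def program_occs_rule[OF assms] if_True if_False
  by (rule iff_exI) blast

lemma clause_true_goal:
  "clause_true (program_occs m) Q \<tau> 17 \<longleftrightarrow>
     \<not> (Q 1 (\<tau> (19 + m)) (\<tau> 19) (\<tau> 1) \<and> Q 2 (\<tau> (19 + m)) (\<tau> 1) (\<tau> 2))"
  unfolding clause_true_iff program_occs_goal
  by (simp add: conj_disj_distribR ex_disj_distrib del: split_paired_Ex)

lemma clause_true_chain:
  assumes "i < m"
  shows "clause_true (program_occs m) Q \<tau> (18 + i) \<longleftrightarrow> Q 0 (\<tau> (19 + i)) (\<tau> (20 + i)) (\<tau> 19)"
  unfolding clause_true_iff program_occs_chain using assms
  by (simp del: split_paired_Ex)

definition program_fm :: "nat \<Rightarrow> fm" where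
  "program_fm m = disj_fm (map occ_fm (program_occs m))"

lemma has_exact_cover_program:
  fixes \<nu> :: "'a::countable \<Rightarrow> nat"
  assumes \<nu>: "bij \<nu>" and "5 \<le> recf_code f"
  defines "\<sigma> \<equiv> \<lambda>y. inv \<nu> (y - 19)" and "\<phi> \<equiv> program_fm (recf_code f)"
  shows "has_exact_cover (denot (universe_expr \<phi>) \<sigma>) (denot (family_expr \<phi>) \<sigma>) \<longleftrightarrow>
    \<not> (\<exists>y. computes f [recf_code f] y)"
proof -
  let ?m = "recf_code f"
  have \<nu>\<sigma>: "\<nu> (\<sigma> (19 + i)) = i" for i
    by (simp add: \<sigma>_def surj_f_inv_f[OF bij_is_surj[OF \<nu>]])
  have inj: "i = j" if "\<sigma> (19 + i) = \<sigma> (19 + j)" for i j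
    using arg_cong[OF that, of \<nu>] unfolding \<nu>\<sigma> .
  have iff: "has_exact_cover (denot (universe_expr \<phi>) \<sigma>) (denot (family_expr \<phi>) \<sigma>) \<longleftrightarrow>
      (\<exists>R. \<forall>\<tau>. (\<forall>y\<ge>19. \<tau> y = \<sigma> y) \<longrightarrow> (\<forall>c<18 + ?m.
       clause_true (program_occs ?m) (\<lambda>k x y z. R [\<sigma> (19 + k), x, y, z]) \<tau> c))"
    using has_exact_cover_iff_clauses[where \<sigma> = \<sigma> and os = "program_occs ?m",
        OF inj wf_program_occs[of _ ?m], unfolded tags_program_occs]
    by (simp only: \<phi>_def program_fm_def Ball_def lessThan_iff)
  show ?thesis
  proof
    assume "has_exact_cover (denot (universe_expr \<phi>) \<sigma>) (denot (family_expr \<phi>) \<sigma>)"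
    then obtain R where R: "\<And>\<tau> c. (\<forall>y\<ge>19. \<tau> y = \<sigma> y) \<Longrightarrow> c < 18 + ?m \<Longrightarrow>
        clause_true (program_occs ?m) (\<lambda>k x y z. R [\<sigma> (19 + k), x, y, z]) \<tau> c"
      unfolding iff by blast
    define Q where "Q = (\<lambda>k x y z. R [\<sigma> (19 + k), x, y, z])"
    have rule: "rule_true Q \<tau> c" if "c < 17" "\<forall>y\<ge>19. \<tau> y = \<sigma> y" for c \<tau>
      using R[OF that(2), of c] that(1) unfolding Q_def clause_true_rule[OF that(1)] by simp
    have chain: "Q 0 (\<sigma> (19 + i)) (\<sigma> (20 + i)) (\<sigma> 19)" if "i < ?m" for i
      using R[of \<sigma> "18 + i"] that clause_true_chain[OF that, of Q \<sigma>] by (simp add: Q_def)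
    have total: "\<exists>y. Q 0 x y (\<sigma> 19)" for x
      using rule[of 0 "\<sigma>(1 := x)"] by (simp add: rule_true_def rules_def)
    \<comment> \<open>Up to \<open>?m\<close> the walk follows the parameters, which the chain
      clauses link; beyond them the totality clause always offers a further successor.\<close>
    define num where
      "num = rec_nat (\<sigma> 19) (\<lambda>n x. if n < ?m then \<sigma> (20 + n) else SOME y. Q 0 x y (\<sigma> 19))"
    have num: "num 0 = \<sigma> 19"
      "num (Suc n) = (if n < ?m then \<sigma> (20 + n) else SOME y. Q 0 (num n) y (\<sigma> 19))" for n
      by (simp_all add: num_def)
    have num_le: "num i = \<sigma> (19 + i)" if "i \<le> ?m" for i
      using that by (cases i) (simp_all add: num)
    interpret rule_model Q \<sigma> num
    proof
      show "num i = \<sigma> (19 + i)" if "i \<le> 5" for i using num_le that assms(2) by simp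
      show "Q 0 (num n) (num (Suc n)) (\<sigma> 19)" for n
      proof (cases "n < ?m")
        case True
        then show ?thesis using chain num_le[of n] by (simp add: num)
      next
        case False
        then show ?thesis using someI_ex[OF total[of "num n"]] by (simp add: num)
      qed
    qed (rule rule)
    show "\<not> (\<exists>y. computes f [?m] y)"
    proof
      assume "\<exists>y. computes f [?m] y"
      then obtain y where y: "computes f [?m] y" by blast
      let ?\<tau> = "\<sigma>(1 := num (cons_code ?m 0), 2 := num y)"
      have "Q 1 (\<sigma> (19 + ?m)) (\<sigma> 19) (num (cons_code ?m 0))"
        using cons[of ?m 0] num(1) num_le[of ?m] by simp
      moreover have "Q 2 (\<sigma> (19 + ?m)) (num (cons_code ?m 0)) (num y)"
        using computes[OF y] num_le[of ?m] by (simp add: cons_code_def)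
      moreover have "clause_true (program_occs ?m) Q ?\<tau> 17"
        unfolding Q_def by (rule R) simp_all
      ultimately show False unfolding clause_true_goal by simp
    qed
  next
    assume halt: "\<not> (\<exists>y. computes f [?m] y)"
    define Q where "Q = (\<lambda>k x y z. std_rel k (\<nu> x) (\<nu> y) (\<nu> z))"
    define R where "R = (\<lambda>l. std_rel (\<nu> (l ! 0)) (\<nu> (l ! 1)) (\<nu> (l ! 2)) (\<nu> (l ! 3)))"
    have R: "(\<lambda>k x y z. R [\<sigma> (19 + k), x, y, z]) = Q"
      by (simp add: R_def Q_def \<nu>\<sigma>)
    have hQ: "holds Q \<tau> l \<longleftrightarrow> holds std_rel (\<nu> \<circ> \<tau>) l" for \<tau> l
      by (cases l) (simp add: Q_def)
    have "clause_true (program_occs ?m) Q \<tau> c"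
      if \<tau>: "\<forall>y\<ge>19. \<tau> y = \<sigma> y" and c: "c < 18 + ?m" for \<tau> c
    proof -
      have v: "(\<nu> \<circ> \<tau>) (19 + i) = i" for i using \<tau> \<nu>\<sigma> by simp
      have v': "(\<nu> \<circ> \<tau>) 19 = 0" "(\<nu> \<circ> \<tau>) 20 = 1" "(\<nu> \<circ> \<tau>) 21 = 2" "(\<nu> \<circ> \<tau>) 22 = 3"
        "(\<nu> \<circ> \<tau>) 23 = 4" "(\<nu> \<circ> \<tau>) 24 = 5"
        using v[of 0] v[of 1] v[of 2] v[of 3] v[of 4] v[of 5] by simp_all
      from c show ?thesis
      proof (cases rule: tag_cases)
        case 1
        from std_rel_rules[OF 1 v'] obtain w where
          w: "(\<forall>l\<in>set (fst (rules ! c)). holds std_rel ((\<nu> \<circ> \<tau>)(17 := w)) l) \<longrightarrow>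
            (\<exists>l\<in>set (snd (rules ! c)). holds std_rel ((\<nu> \<circ> \<tau>)(17 := w)) l)"
          unfolding rule_true_def by blast
        \<comment> \<open>The number that witnesses the rule must itself be an atom, which
          surjectivity of \<open>\<nu>\<close> provides.\<close>
        have "(\<nu> \<circ> \<tau>)(17 := w) = \<nu> \<circ> (\<tau>(17 := inv \<nu> w))"
          by (simp add: fun_eq_iff surj_f_inv_f[OF bij_is_surj[OF \<nu>]])
        then show ?thesis
          using w unfolding clause_true_rule[OF 1] rule_true_def hQ by (intro exI[of _ "inv \<nu> w"]) simp
      next
        case 2
        have "\<not> comp_rel ?m (cons_code ?m 0) y" for y
          using comp_rel_sound(1)[of ?m "cons_code ?m 0" y f] halt by auto
        then show ?thesis
          using v[of ?m] v'(1) unfolding 2 clause_true_goal by (auto simp: Q_def)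
      next
        case (3 i)
        show ?thesis
          using v[of i] v[of "Suc i"] unfolding 3(2) clause_true_chain[OF 3(1)] by (simp add: Q_def)
      qed
    qed
    then show "has_exact_cover (denot (universe_expr \<phi>) \<sigma>) (denot (family_expr \<phi>) \<sigma>)"
      unfolding iff by (intro exI[of _ R]) (simp add: R)
  qed
qed

section \<open>Presentations\<close>

primrec valuation :: "('a \<Rightarrow> nat) \<Rightarrow> nat \<Rightarrow> (var \<times> 'a) list" where
  "valuation \<nu> 0 = []"
| "valuation \<nu> (Suc n) = (19 + n, inv \<nu> n) # valuation \<nu> n"

lemma set_valuation: "set (map fst (valuation \<nu> n)) = {19..<19 + n}"
  by (induction n) auto

lemma distinct_valuation: "distinct (map fst (valuation \<nu> n))"
  by (induction n) (simp_all del: set_map add: set_valuation)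

lemma map_of_valuation: "19 \<le> y \<Longrightarrow> y < 19 + n \<Longrightarrow> map_of (valuation \<nu> n) y = Some (inv \<nu> (y - 19))"
  by (induction n) auto

lemma fv_universe_expr: "fv (universe_expr \<phi>) = fv_fm \<phi> - {..<19}"
  unfolding universe_expr_def by (auto simp: set_vars)

text \<open>The sign tests mention parameter 19 themselves; since it already occurs in
  \<open>\<phi>\<close>, universe and family have the same free variables and share one
  valuation.\<close>

lemma fv_family_expr: "19 \<in> fv_fm \<phi> \<Longrightarrow> fv (family_expr \<phi>) = fv_fm \<phi> - {..<19}"
  unfolding family_expr_def fact_expr_def by (auto simp: set_vars)

lemma fv_fm_disj_fm: "fv_fm (disj_fm \<phi>s) = (\<Union>\<phi>\<in>set \<phi>s. fv_fm \<phi>)"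
  by (induction \<phi>s) auto

lemma rule_vars_less:
  assumes "c < 17"
  shows "\<forall>(k, x, y, z) \<in> set (fst (rules ! c)) \<union> set (snd (rules ! c)). k < 6 \<and> x < 25 \<and> y < 25 \<and> z < 25"
  by (rule less_17_cases[OF assms]) (simp_all add: rules_def)

lemma program_occs_vars_less:
  assumes "(c, b, k, x, y, z) \<in> set (program_occs m)"
  shows "c < 18 + m \<and> k < 6 \<and> x < 37 + m \<and> y < 37 + m \<and> z < 37 + m"
proof -
  have "c \<in> {..<18 + m}" using assms unfolding tags_program_occs[symmetric] by force
  then have c: "c < 18 + m" by simp
  then show ?thesis
  proof (cases rule: tag_cases)
    case 1
    then have "(k, x, y, z) \<in> set (fst (rules ! c)) \<union> set (snd (rules ! c))"
      using assms program_occs_rule[OF 1] by (simp split: if_splits)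
    from bspec[OF rule_vars_less[OF 1] this] have "k < 6 \<and> x < 25 \<and> y < 25 \<and> z < 25" by simp
    then show ?thesis using c by linarith
  next
    case 2
    then show ?thesis using assms by (auto simp: program_occs_goal)
  next
    case (3 i)
    then show ?thesis using assms by (auto simp: program_occs_chain)
  qed
qed

text \<open>The clause tags \<open>19 + c\<close> with \<open>c < 18 + m\<close> already fill the
  interval, and all other parameters lie in it.\<close>

lemma fv_program_fm: "fv_fm (program_fm m) - {..<19} = {19..<37 + m}"
proof (intro equalityI subsetI)
  fix u assume "u \<in> fv_fm (program_fm m) - {..<19}"
  then obtain c b k x y z where oc: "(c, b, k, x, y, z) \<in> set (program_occs m)"
    and u: "u \<in> fv_fm (occ_fm (c, b, k, x, y, z))" "19 \<le> u"
    unfolding program_fm_def fv_fm_disj_fm by force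
  show "u \<in> {19..<37 + m}"
    using program_occs_vars_less[OF oc] u by (simp split: if_splits) linarith+
next
  fix u assume u: "u \<in> {19..<37 + m}"
  then have "u - 19 \<in> fst ` set (program_occs m)" unfolding tags_program_occs by auto
  then obtain b k x y z where oc: "(u - 19, b, k, x, y, z) \<in> set (program_occs m)" by auto
  have "u \<in> fv_fm (occ_fm (u - 19, b, k, x, y, z))" using u by simp
  then show "u \<in> fv_fm (program_fm m) - {..<19}"
    using oc u unfolding program_fm_def fv_fm_disj_fm by force
qed

definition universe_pres :: "('a \<Rightarrow> nat) \<Rightarrow> nat \<Rightarrow> 'a pres" where
  "universe_pres \<nu> m = (universe_expr (program_fm m), valuation \<nu> (18 + m))"

definition family_pres :: "('a \<Rightarrow> nat) \<Rightarrow> nat \<Rightarrow> 'a pres" where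
  "family_pres \<nu> m = (family_expr (program_fm m), valuation \<nu> (18 + m))"

lemma fv_exprs:
  "fv (universe_expr (program_fm m)) = {19..<37 + m}" "fv (family_expr (program_fm m)) = {19..<37 + m}"
proof -
  have "19 \<in> fv_fm (program_fm m) - {..<19}" unfolding fv_program_fm by simp
  then have "19 \<in> fv_fm (program_fm m)" by blast
  then show "fv (universe_expr (program_fm m)) = {19..<37 + m}"
    "fv (family_expr (program_fm m)) = {19..<37 + m}"
    by (simp_all only: fv_universe_expr fv_family_expr fv_program_fm)
qed

lemma is_pres_program: "is_pres (universe_pres \<nu> m)" "is_pres (family_pres \<nu> m)"
  unfolding is_pres_def universe_pres_def family_pres_def
  using distinct_valuation[of \<nu> "18 + m"] set_valuation[of \<nu> "18 + m"] by (simp_all add: fv_exprs)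

lemma pres_val_program:
  fixes \<nu> :: "'a::countable \<Rightarrow> nat"
  shows "pres_val (universe_pres \<nu> m) = denot (universe_expr (program_fm m)) (\<lambda>y. inv \<nu> (y - 19))"
    "pres_val (family_pres \<nu> m) = denot (family_expr (program_fm m)) (\<lambda>y. inv \<nu> (y - 19))"
  unfolding pres_val_def universe_pres_def family_pres_def case_prod_conv
  by (rule denot_cong(1), simp add: fv_exprs map_of_valuation)+

lemma program_inputs:
  fixes \<nu> :: "'a::countable \<Rightarrow> nat"
  shows "(universe_pres \<nu> m, family_pres \<nu> m) \<in> exact_cover_inputs"
  by (simp add: exact_cover_inputs_def is_pres_program pres_val_program set_system_exprs)

section \<open>Computability of the reduction\<close>

definition rec_fun :: "nat \<Rightarrow> (nat list \<Rightarrow> nat) \<Rightarrow> bool" where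
  "rec_fun k F \<longleftrightarrow> (\<exists>f. \<forall>xs. length xs = k \<longrightarrow> computes f xs (F xs))"

lemma computes_Comp1: "computes g xs y \<Longrightarrow> computes f [y] z \<Longrightarrow> computes (recf.Comp f [g]) xs z"
  by (rule computes.Comp[where ys = "[y]"]) simp_all

lemma computes_Comp2:
  "computes g xs y \<Longrightarrow> computes h xs y' \<Longrightarrow> computes f [y, y'] z \<Longrightarrow> computes (recf.Comp f [g, h]) xs z"
  by (rule computes.Comp[where ys = "[y, y']"]) simp_all

lemma rec_fun_Suc: "rec_fun k F \<Longrightarrow> rec_fun k (\<lambda>xs. Suc (F xs))"
  unfolding rec_fun_def by (meson computes_Comp1 computes.Succ)

lemma rec_fun_const: "rec_fun k (\<lambda>_. c)"
proof (induction c)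
  case 0
  then show ?case unfolding rec_fun_def using computes.Zero by blast
qed (rule rec_fun_Suc)

lemma rec_fun_nth: "i < k \<Longrightarrow> rec_fun k (\<lambda>xs. xs ! i)"
  unfolding rec_fun_def using computes.Proj by blast

lemma rec_fun_comp:
  assumes "rec_fun 1 (\<lambda>xs. w (xs ! 0))" "rec_fun k F"
  shows "rec_fun k (\<lambda>xs. w (F xs))"
proof -
  obtain g where g: "\<And>xs. length xs = 1 \<Longrightarrow> computes g xs (w (xs ! 0))"
    using assms(1) unfolding rec_fun_def by blast
  obtain f where f: "\<And>xs. length xs = k \<Longrightarrow> computes f xs (F xs)"
    using assms(2) unfolding rec_fun_def by blast
  have "computes (recf.Comp g [f]) xs (w (F xs))" if "length xs = k" for xs
    using computes_Comp1[OF f[OF that]] g[of "[F xs]"] by simp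
  then show ?thesis unfolding rec_fun_def by blast
qed

text \<open>Recursion without parameters suffices for triangle numbers, the chain of clauses and the
  valuation.\<close>

lemma rec_fun_rec:
  assumes "rec_fun 2 (\<lambda>xs. G (xs ! 0) (xs ! 1))" and Suc: "\<And>n. w (Suc n) = G n (w n)"
  shows "rec_fun 1 (\<lambda>xs. w (xs ! 0))"
proof -
  obtain g where g: "\<And>xs. length xs = 2 \<Longrightarrow> computes g xs (G (xs ! 0) (xs ! 1))"
    using assms(1) unfolding rec_fun_def by blast
  obtain f where f: "computes f [] (w 0)"
    using rec_fun_const[of 0 "w 0"] unfolding rec_fun_def by auto
  have "computes (PrimRec f g) [n] (w n)" for n
  proof (induction n)
    case 0
    show ?case using f by (rule computes.PrimRec_0)
  next
    case (Suc n)
    then show ?case using g[of "[n, w n]"] by (auto simp: assms(2) intro: computes.PrimRec_Suc)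
  qed
  then have "computes (PrimRec f g) xs (w (xs ! 0))" if "length xs = 1" for xs
    using that by (cases xs) auto
  then show ?thesis unfolding rec_fun_def by blast
qed

lemma rec_fun_add:
  assumes "rec_fun k F" "rec_fun k G"
  shows "rec_fun k (\<lambda>xs. F xs + G xs)"
proof -
  let ?add = "PrimRec (recf.Proj 0) (recf.Comp recf.Succ [recf.Proj 1])"
  have add: "computes ?add [m, n] (m + n)" for m n
  proof (induction m)
    case 0
    show ?case using computes.PrimRec_0[OF computes.Proj[of 0 "[n]"]] by simp
  next
    case (Suc m)
    have "computes (recf.Comp recf.Succ [recf.Proj 1]) [m, m + n, n] (Suc (m + n))"
      using computes_Comp1[OF computes.Proj[of 1 "[m, m + n, n]"]] computes.Succ by simp
    then show ?case using computes.PrimRec_Suc[OF Suc] by simp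
  qed
  obtain f where f: "\<And>xs. length xs = k \<Longrightarrow> computes f xs (F xs)"
    using assms(1) unfolding rec_fun_def by blast
  obtain g where g: "\<And>xs. length xs = k \<Longrightarrow> computes g xs (G xs)"
    using assms(2) unfolding rec_fun_def by blast
  have "computes (recf.Comp ?add [f, g]) xs (F xs + G xs)" if "length xs = k" for xs
    using computes_Comp2[OF f[OF that] g[OF that] add] .
  then show ?thesis unfolding rec_fun_def by blast
qed

lemma rec_fun_prod_encode:
  assumes "rec_fun k F" "rec_fun k G"
  shows "rec_fun k (\<lambda>xs. prod_encode (F xs, G xs))"
proof -
  have "rec_fun 1 (\<lambda>xs. triangle (xs ! 0))"
    by (rule rec_fun_rec[where G = "\<lambda>n r. r + Suc n"])
      (simp_all add: rec_fun_add rec_fun_Suc rec_fun_nth del: add_Suc_right)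
  from rec_fun_comp[OF this rec_fun_add[OF assms]] show ?thesis
    unfolding prod_encode_def by (simp add: rec_fun_add assms)
qed

lemmas rec_fun_intros = rec_fun_const rec_fun_prod_encode rec_fun_Suc rec_fun_add rec_fun_nth

text \<open>The rule clauses contribute a constant code, and each chain clause puts one disjunct in
  front of the previous formula: primitive recursion in \<open>m\<close>.\<close>

lemma rec_fun_program_fm: "rec_fun 1 (\<lambda>xs. fm_code (program_fm (xs ! 0)))"
proof -
  have "rec_fun 1 (\<lambda>xs. fm_code (disj_fm (map occ_fm (chain_occs (xs ! 0)))))"
  proof (rule rec_fun_rec)
    show "rec_fun 2 (\<lambda>xs. prod_encode (4, prod_encode
        (fm_code (occ_fm (18 + xs ! 0, True, suc_lit (19 + xs ! 0) (20 + xs ! 0))), xs ! 1)))"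
      unfolding occ_fm.simps fm_code.simps if_True by (intro rec_fun_intros) simp_all
  qed simp
  then show ?thesis
    unfolding program_fm_def program_occs_def list.map disj_fm.simps fm_code.simps occ_fm.simps
    by (intro rec_fun_intros) simp_all
qed

lemma rec_fun_universe_expr:
  "rec_fun k (\<lambda>xs. fm_code (\<phi> xs)) \<Longrightarrow> rec_fun k (\<lambda>xs. expr_code (universe_expr (\<phi> xs)))"
  unfolding universe_expr_def expr_code.simps list.map list_encode.simps builder_code.simps
  by (intro rec_fun_intros)

lemma rec_fun_family_expr:
  "rec_fun k (\<lambda>xs. fm_code (\<phi> xs)) \<Longrightarrow> rec_fun k (\<lambda>xs. expr_code (family_expr (\<phi> xs)))"
  unfolding family_expr_def fact_expr_def expr_code.simps list.map list_encode.simps builder_code.simps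
    fm_code.simps
  by (intro rec_fun_intros)

text \<open>Parameter \<open>19 + n\<close> receives the atom with number \<open>n\<close>, so the
  code of the valuation is computable whatever \<open>\<nu>\<close> is.\<close>

lemma rec_fun_input_code:
  assumes "bij \<nu>"
  shows "rec_fun 1 (\<lambda>xs. input_code \<nu> (universe_pres \<nu> (xs ! 0), family_pres \<nu> (xs ! 0)))"
proof -
  have \<nu>: "\<nu> (inv \<nu> n) = n" for n
    by (rule surj_f_inv_f[OF bij_is_surj[OF assms]])
  have "rec_fun 1 (\<lambda>xs. list_encode (map (\<lambda>(x, a). prod_encode (x, \<nu> a)) (valuation \<nu> (xs ! 0))))"
    by (rule rec_fun_rec[where G = "\<lambda>n r. Suc (prod_encode (prod_encode (19 + n, n), r))"])
      (simp_all add: \<nu> rec_fun_intros)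
  from rec_fun_comp[OF this rec_fun_add[OF rec_fun_const[of _ 18] rec_fun_nth[of 0]]]
  have val: "rec_fun 1 (\<lambda>xs. list_encode (map (\<lambda>(x, a). prod_encode (x, \<nu> a)) (valuation \<nu> (18 + xs ! 0))))"
    by simp
  show ?thesis
    unfolding input_code_def pres_code_def universe_pres_def family_pres_def case_prod_conv
    by (intro rec_fun_intros val rec_fun_universe_expr rec_fun_family_expr rec_fun_program_fm)
qed

section \<open>Diagonalization\<close>

theorem theorem3p3:
  fixes \<nu> :: "'a::countable \<Rightarrow> nat"
  assumes "bij \<nu>"
  shows "\<not> decidable_problem (input_code \<nu>) exact_cover_inputs exact_cover_yes"
proof
  assume "decidable_problem (input_code \<nu>) exact_cover_inputs exact_cover_yes"
  then obtain d where d: "\<And>i. i \<in> exact_cover_inputs \<Longrightarrow>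
      computes d [input_code \<nu> i] (if i \<in> exact_cover_yes then 1 else 0)"
    unfolding decidable_problem_def by blast
  define inst where "inst m = (universe_pres \<nu> m, family_pres \<nu> m)" for m
  obtain c where c: "\<And>xs. length xs = 1 \<Longrightarrow> computes c xs (input_code \<nu> (inst (xs ! 0)))"
    using rec_fun_input_code[OF assms] unfolding rec_fun_def inst_def by blast
  define neg where "neg = PrimRec (recf.Comp recf.Succ [recf.Zero]) recf.Zero"
  \<comment> \<open>\<open>Proj 1\<close> ignores the search variable: \<open>Mu body\<close> on
    \<open>m\<close> stops at 0 if the procedure accepts instance \<open>m\<close>, and searches
    forever if it rejects it. With \<open>m\<close> the code of \<open>Mu body\<close>, acceptance
    means by the reduction that this very run does not halt.\<close>
  define body where "body = recf.Comp neg [recf.Comp d [recf.Comp c [recf.Proj 1]]]"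
  define m where "m = recf_code (recf.Mu body)"
  have neg0: "computes neg [0] 1"
    unfolding neg_def One_nat_def
    by (intro computes.PrimRec_0 computes_Comp1[OF computes.Zero computes.Succ])
  have neg1: "computes neg [1] 0"
    using computes.PrimRec_Suc[OF neg0[unfolded neg_def] computes.Zero] by (simp add: neg_def)
  have body: "computes body [n, m] s" if "computes neg [if inst m \<in> exact_cover_yes then 1 else 0] s" for n s
  proof -
    have "computes (recf.Comp c [recf.Proj 1]) [n, m] (input_code \<nu> (inst m))"
      using computes_Comp1[OF computes.Proj[of 1 "[n, m]"]] c[of "[m]"] by simp
    then have "computes (recf.Comp d [recf.Comp c [recf.Proj 1]]) [n, m]
        (if inst m \<in> exact_cover_yes then 1 else 0)"
      by (rule computes_Comp1) (rule d, unfold inst_def, rule program_inputs)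
    then show ?thesis unfolding body_def using that by (rule computes_Comp1)
  qed
  \<comment> \<open>The constructor tag of \<open>Mu\<close> is 5, and a pair code exceeds its first
    component; so the chain reaches all tags.\<close>
  have "5 \<le> m" using cons_code_gt[of 5] by (simp add: m_def less_imp_le)
  then have yes: "inst m \<in> exact_cover_yes \<longleftrightarrow> \<not> (\<exists>y. computes (recf.Mu body) [m] y)"
    using has_exact_cover_program[OF assms, of "recf.Mu body"] program_inputs[of \<nu> m]
    by (simp add: exact_cover_yes_def inst_def pres_val_program m_def)
  show False
  proof (cases "inst m \<in> exact_cover_yes")
    case True
    then have "computes body [0, m] 0" using body neg1 by simp
    then have "computes (recf.Mu body) [m] 0" by (rule computes.Mu) simp
    then show False using True yes by blast
  next
    case False
    then obtain y where "computes (recf.Mu body) [m] y" using yes by blast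
    then have "computes body [y, m] 0" by (rule computes_MuE)
    moreover have "computes body [y, m] 1" using body neg0 False by simp
    ultimately show False using computes_deterministic by fastforce
  qed
qed

end
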